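(* Let $H$ be the graph obtained from a $4$-cycle $abcda$ by attaching a triangle at $a$, a triangle at $c$, and pendant edges at $b$ and $d$; explicitly, $H$ has the ten vertices $a,b,c,d,u,v,x,y,\ell,m$ and the twelve edges $ab, bc, cd, da, au, av, uv, cx, cy, xy, b\ell, dm$. Let $G = L(H)$ be the line graph of $H$ ($12$ vertices, $22$ edges, graph6 code \texttt{K?\textasciigrave CRAWWUXIM}). Then $G$ is connected and claw-free, and the coefficient of the Schur function $s_{(3,3,3,3)}$ in the Schur expansion of the chromatic symmetric function $X_G$ is $$[s_{(3,3,3,3)}]\, X_G = -64.$$
   Context: All graphs are finite and simple. The line graph $L(H)$ has as vertices the edges of $H$, two distinct edges of $H$ being adjacent in $L(H)$ iff they share an endpoint. A graph is claw-free if it has no induced subgraph isomorphic to $K_{1,3}$. For a finite simple graph $G=(V,E)$, the chromatic symmetric function is $X_G = \sum_{\kappa} \prod_{v\in V} x_{\kappa(v)}$, where the sum is over all proper colourings $\kappa\colon V\to\{1,2,3,\dots\}$ (i.e. $\kappa(v)\neq\kappa(w)$ whenever $vw\in E$), in commuting variables $x_1,x_2,\dots$. It is a homogeneous symmetric function of degree $|V|$ with integer coefficients. For a partition $\nu$ of $|V|$, $[s_\nu]X_G$ denotes the coefficient of the Schur function $s_\nu$ when $X_G$ is expanded in the Schur basis. The graph6 code merely records the isomorphism type of $G$. Decoded, it is the graph on vertex set $\{0,1,\dots,11\}$ with edges $\{0,4\},\{1,5\},\{0,6\},\{4,6\},\{1,7\},\{2,7\},\{0,8\},\{3,8\},\{4,8\},\{1,9\},\{2,9\},\{7,9\},\{0,10\},\{1,10\},\{4,10\},\{5,10\},\{8,10\},\{1,11\},\{3,11\},\{7,11\},\{8,11\},\{9,11\}$.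 *)

theory Defs
  imports Main "HOL-Library.FuncSet" "HOL-Library.Multiset"
begin

section \<open>Graphs\<close>

record 'a ugraph =
  verts :: "'a set"
  edges :: "'a set set"

definition simple_graph :: "'a ugraph \<Rightarrow> bool" where
  "simple_graph G \<longleftrightarrow> finite (verts G) \<and> (\<forall>e\<in>edges G. e \<subseteq> verts G \<and> card e = 2)"

definition graph_iso :: "'a ugraph \<Rightarrow> 'b ugraph \<Rightarrow> bool" where
  "graph_iso G H \<longleftrightarrow>
     (\<exists>f. bij_betw f (verts G) (verts H) \<and> (\<lambda>e. f ` e) ` edges G = edges H)"

definition induced_subgraph :: "'a ugraph \<Rightarrow> 'a set \<Rightarrow> 'a ugraph" where
  "induced_subgraph G W = \<lparr>verts = W, edges = {e \<in> edges G. e \<subseteq> W}\<rparr>"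

definition connected_graph :: "'a ugraph \<Rightarrow> bool" where
  "connected_graph G \<longleftrightarrow> verts G \<noteq> {} \<and>
     (\<forall>u\<in>verts G. \<forall>v\<in>verts G. (u, v) \<in> {(x, y). {x, y} \<in> edges G}\<^sup>*)"

definition claw :: "nat ugraph" where
  "claw = \<lparr>verts = {0, 1, 2, 3}, edges = {{0, 1}, {0, 2}, {0, 3}}\<rparr>"

definition claw_free :: "'a ugraph \<Rightarrow> bool" where
  "claw_free G \<longleftrightarrow> \<not> (\<exists>W \<subseteq> verts G. graph_iso (induced_subgraph G W) claw)"

definition line_graph :: "'a ugraph \<Rightarrow> 'a set ugraph" where
  "line_graph H = \<lparr>verts = edges H,
     edges = {{e, f} | e f. e \<in> edges H \<and> f \<in> edges H \<and> e \<noteq> f \<and> e \<inter> f \<noteq> {}}\<rparr>"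

lemma simple_graph_line_graph:
  assumes "simple_graph H"
  shows "simple_graph (line_graph H)"
proof -
  have "edges H \<subseteq> Pow (verts H)"
    using assms by (auto simp: simple_graph_def)
  then have "finite (edges H)"
    using assms by (metis simple_graph_def finite_Pow_iff finite_subset)
  moreover have "card {e, f} = 2" if "e \<noteq> f" for e f :: "'a set"
    using that by simp
  ultimately show ?thesis
    unfolding simple_graph_def line_graph_def by (simp, blast)
qed


section \<open>Symmetric functions\<close>

text \<open>
  A formal power series with integer coefficients in the commuting variables
  \<open>x\<^sub>1, x\<^sub>2, \<dots>\<close> is given by its coefficient function. The monomial
  \<open>x\<^sub>i\<^sub>1 \<cdots> x\<^sub>i\<^sub>k\<close> is the multiset of its variable indices; as indices start at 1,
  the series below vanish on multisets containing 0.
\<close>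

type_synonym pseries = "nat multiset \<Rightarrow> int"

definition proper_colourings :: "'a ugraph \<Rightarrow> ('a \<Rightarrow> nat) set" where
  "proper_colourings G = {\<kappa> \<in> verts G \<rightarrow>\<^sub>E {1..}.
     \<forall>v\<in>verts G. \<forall>w\<in>verts G. {v, w} \<in> edges G \<longrightarrow> \<kappa> v \<noteq> \<kappa> w}"

definition chromatic_symmetric_function :: "'a ugraph \<Rightarrow> pseries" where
  "chromatic_symmetric_function G M =
     int (card {\<kappa> \<in> proper_colourings G. image_mset \<kappa> (mset_set (verts G)) = M})"

definition is_partition :: "nat list \<Rightarrow> bool" where
  "is_partition p \<longleftrightarrow> sorted_wrt (\<ge>) p \<and> 0 \<notin> set p"

text \<open>Young diagrams in English notation: cell \<open>(i, j)\<close> is in row \<open>i\<close> and column \<open>j\<close>,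
  counted from 0.\<close>

definition young_diagram :: "nat list \<Rightarrow> (nat \<times> nat) set" where
  "young_diagram p = {(i, j). i < length p \<and> j < p ! i}"

definition semistandard_tableaux :: "nat list \<Rightarrow> (nat \<times> nat \<Rightarrow> nat) set" where
  "semistandard_tableaux p = {T \<in> young_diagram p \<rightarrow>\<^sub>E {1..}.
     (\<forall>i j. (i, j) \<in> young_diagram p \<longrightarrow> (i, Suc j) \<in> young_diagram p \<longrightarrow> T (i, j) \<le> T (i, Suc j)) \<and>
     (\<forall>i j. (i, j) \<in> young_diagram p \<longrightarrow> (Suc i, j) \<in> young_diagram p \<longrightarrow> T (i, j) < T (Suc i, j))}"

definition schur_function :: "nat list \<Rightarrow> pseries" where
  "schur_function p M =
     int (card {T \<in> semistandard_tableaux p. image_mset T (mset_set (young_diagram p)) = M})"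

definition is_schur_expansion :: "pseries \<Rightarrow> (nat list \<Rightarrow> int) \<Rightarrow> bool" where
  "is_schur_expansion f c \<longleftrightarrow>
     (\<forall>p. c p \<noteq> 0 \<longrightarrow> is_partition p) \<and> finite {p. c p \<noteq> 0} \<and>
     (\<forall>M. f M = (\<Sum>p | c p \<noteq> 0. c p * schur_function p M))"

text \<open>Meaningful only when \<open>f\<close> is a symmetric function (of bounded degree): then the
  expansion exists and is unique, the Schur functions being a basis over the integers.\<close>

definition schur_coeff :: "pseries \<Rightarrow> nat list \<Rightarrow> int" where
  "schur_coeff f p = (THE c. is_schur_expansion f c) p"


section \<open>The graph\<close>

datatype vtx = Va | Vb | Vc | Vd | Vu | Vv | Vx | Vy | Vl | Vm

definition graph_H :: "vtx ugraph" where
  "graph_H = \<lparr>verts = {Va, Vb, Vc, Vd, Vu, Vv, Vx, Vy, Vl, Vm},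
     edges = {{Va, Vb}, {Vb, Vc}, {Vc, Vd}, {Vd, Va},
              {Va, Vu}, {Va, Vv}, {Vu, Vv},
              {Vc, Vx}, {Vc, Vy}, {Vx, Vy},
              {Vb, Vl}, {Vd, Vm}}\<rparr>"

lemma simple_graph_H: "simple_graph graph_H"
  by (simp add: simple_graph_def graph_H_def)

text \<open>The graph with graph6 code \<^verbatim>\<open>K?`CRAWWUXIM\<close>, decoded.\<close>

definition graph6_decoded :: "nat ugraph" where
  "graph6_decoded = \<lparr>verts = {0..11},
     edges = {{0, 4}, {1, 5}, {0, 6}, {4, 6}, {1, 7}, {2, 7}, {0, 8}, {3, 8}, {4, 8},
              {1, 9}, {2, 9}, {7, 9}, {0, 10}, {1, 10}, {4, 10}, {5, 10}, {8, 10},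
              {1, 11}, {3, 11}, {7, 11}, {8, 11}, {9, 11}}\<rparr>"

end

theory Submission
  imports Defs "HOL-Library.List_Lexorder"
begin

text \<open>
  A proper colouring and a semistandard tableau can both be dismantled by removing one colour at a
  time, the largest first: a colouring loses stable sets, a tableau loses horizontal strips. Both
  counts thus satisfy the same recursion in the content, and both are invariant under permutations
  of the content because two consecutive layers can be exchanged: by swapping the two stable sets,
  respectively by the Bender--Knuth involution. If the largest part of the content is removed
  first, a horizontal strip as long as the first row leaves exactly the remaining rows; hence the
  Kostka matrix is unitriangular for the lexicographic order, and every chromatic symmetric
  function has a unique Schur expansion.

  In the line graph at hand all stable sets have at most 4 elements, so all Schur coefficients at
  partitions with a part of size at least 5 vanish. The partitions of 12 with at most 4 parts, all
  at most 4, are 444, 4431, 4422, 4332 and 3333; solving the corresponding triangular system with the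
  colouring numbers 0, 0, 128, 320 and 768 gives \<open>768 - 2 * 128 - 3 * 192 = -64\<close>.
\<close>

section \<open>Contents as lists of multiplicities; counting by layers\<close>

section \<open>Removing colours one at a time\<close>

text \<open>The list prescribes the multiplicities from the largest colour, its length, down to 1.\<close>

fun content_mset :: "nat list \<Rightarrow> nat multiset" where
  "content_mset [] = {#}"
| "content_mset (a # as) = replicate_mset a (Suc (length as)) + content_mset as"

lemma content_mset_bounds: "x \<in># content_mset as \<Longrightarrow> 1 \<le> x \<and> x \<le> length as"
  by (induction as) (auto split: if_splits)

lemma content_mset_surj_aux:
  "(\<And>x. x \<in># M \<Longrightarrow> 1 \<le> x \<and> x \<le> n) \<Longrightarrow> \<exists>as. length as = n \<and> M = content_mset as"
proof (induction n arbitrary: M)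
  case 0
  then have "M = {#}" by (metis le_zero_eq multiset_nonemptyE not_one_le_zero)
  then show ?case by simp
next
  case (Suc n)
  let ?M' = "filter_mset (\<lambda>x. x \<noteq> Suc n) M"
  have "1 \<le> x \<and> x \<le> n" if "x \<in># ?M'" for x
    using Suc.prems[of x] that by auto
  from Suc.IH[of ?M'] this obtain as where as: "length as = n" "?M' = content_mset as" by blast
  have "M = filter_mset (\<lambda>x. x = Suc n) M + ?M'"
    by (metis multiset_partition)
  also have "filter_mset (\<lambda>x. x = Suc n) M = replicate_mset (count M (Suc n)) (Suc n)"
    by (rule filter_eq_replicate_mset)
  finally have "M = content_mset (count M (Suc n) # as)"
    using as by simp
  then show ?case using as(1) by (metis length_Cons)
qed

text \<open>Multiplicities are read off from the largest index down to 1, so a series vanishing on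
  monomials that contain 0 is determined by its values at lists.\<close>

lemma content_mset_surj:
  assumes "0 \<notin># M" obtains as where "M = content_mset as"
proof -
  have "1 \<le> x \<and> x \<le> Max (set_mset M)" if "x \<in># M" for x
    using that assms by (metis Max_ge One_nat_def Suc_leI finite_set_mset gr0I)
  then show ?thesis using content_mset_surj_aux that by blast
qed

text \<open>A layer is represented by the set \<open>T\<close> left after its removal, since the
  recursion continues on \<open>T\<close>.\<close>

definition layers :: "('a set \<Rightarrow> 'a set \<Rightarrow> bool) \<Rightarrow> 'a set \<Rightarrow> nat \<Rightarrow> 'a set set" where
  "layers ok S a = {T. T \<subseteq> S \<and> ok S T \<and> card (S - T) = a}"

primrec peel_count :: "('a set \<Rightarrow> 'a set \<Rightarrow> bool) \<Rightarrow> 'a set \<Rightarrow> nat list \<Rightarrow> nat" where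
  "peel_count ok S [] = (if S = {} then 1 else 0)"
| "peel_count ok S (a # as) = (\<Sum>T\<in>layers ok S a. peel_count ok T as)"

lemma finite_layers: "finite S \<Longrightarrow> finite (layers ok S a)"
  unfolding layers_def by (rule finite_subset[of _ "Pow S"]) auto

text \<open>\<open>F_peel\<close> splits off the cells with top value \<open>N\<close>, which need
  not occur. The combinatorial content is in \<open>exchange\<close>: two layers can be removed in
  either order of sizes, which makes all counts symmetric in the content.\<close>

locale peeling =
  fixes Inv :: "'a set \<Rightarrow> bool" and ok :: "'a set \<Rightarrow> 'a set \<Rightarrow> bool"
    and F :: "'a set \<Rightarrow> ('a \<Rightarrow> nat) set"
  assumes fin: "Inv S \<Longrightarrow> finite S"
    and inv: "Inv S \<Longrightarrow> T \<subseteq> S \<Longrightarrow> ok S T \<Longrightarrow> Inv T"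
    and ok_refl: "Inv S \<Longrightarrow> ok S S"
    and F_funcset: "F S \<subseteq> S \<rightarrow>\<^sub>E {1..}"
    and F_empty: "(\<lambda>_. undefined) \<in> F {}"
    and F_peel: "Inv S \<Longrightarrow> \<kappa> \<in> S \<rightarrow>\<^sub>E {1..N} \<Longrightarrow>
       \<kappa> \<in> F S \<longleftrightarrow> ok S {c \<in> S. \<kappa> c < N} \<and> restrict \<kappa> {c \<in> S. \<kappa> c < N} \<in> F {c \<in> S. \<kappa> c < N}"
    and exchange: "Inv S \<Longrightarrow> U \<subseteq> S \<Longrightarrow>
       card {T \<in> layers ok S a. U \<in> layers ok T b} = card {T \<in> layers ok S b. U \<in> layers ok T a}"
begin

definition fillings :: "'a set \<Rightarrow> nat multiset \<Rightarrow> ('a \<Rightarrow> nat) set" where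
  "fillings S M = {\<kappa> \<in> F S. image_mset \<kappa> (mset_set S) = M}"

lemma fillings_values:
  assumes "finite S" "\<kappa> \<in> fillings S M" "c \<in> S" shows "\<kappa> c \<in># M"
  using assms by (auto simp: fillings_def)

lemma layer_sizes:
  fixes \<kappa> :: "'a \<Rightarrow> nat"
  assumes "finite S" and im: "image_mset \<kappa> (mset_set S) = replicate_mset a N + M'"
    and lt: "\<And>x. x \<in># M' \<Longrightarrow> x < N"
  shows "card (S - {c \<in> S. \<kappa> c < N}) = a"
    and "image_mset \<kappa> (mset_set {c \<in> S. \<kappa> c < N}) = M'"
proof -
  have le: "\<kappa> c \<le> N" if "c \<in> S" for c
  proof -
    have "\<kappa> c \<in># replicate_mset a N + M'"
      using that assms(1) by (simp flip: im)
    then show ?thesis using lt[of "\<kappa> c"] by (auto split: if_splits)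
  qed
  have "count M' N = 0" using lt by (meson count_inI less_irrefl)
  then have "a = count (image_mset \<kappa> (mset_set S)) N" by (simp add: im)
  also have "\<dots> = card {c \<in> S. \<kappa> c = N}"
    using assms(1) by (auto simp: count_image_mset' intro: arg_cong[where f = card])
  also have "{c \<in> S. \<kappa> c = N} = S - {c \<in> S. \<kappa> c < N}"
    using le by fastforce
  finally show "card (S - {c \<in> S. \<kappa> c < N}) = a" by simp
  have "image_mset \<kappa> (mset_set {c \<in> S. \<kappa> c < N}) = filter_mset (\<lambda>x. x < N) (image_mset \<kappa> (mset_set S))"
    using assms(1) by (simp add: filter_mset_image_mset)
  also have "\<dots> = filter_mset (\<lambda>x. x < N) (replicate_mset a N) + filter_mset (\<lambda>x. x < N) M'"
    by (simp add: im)
  also have "filter_mset (\<lambda>x. x < N) (replicate_mset a N) = {#}"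
    by (induction a) auto
  also have "filter_mset (\<lambda>x. x < N) M' = M'"
    using lt by (simp add: filter_mset_eq_conv)
  finally show "image_mset \<kappa> (mset_set {c \<in> S. \<kappa> c < N}) = M'" by simp
qed

text \<open>A filling amounts to the set \<open>T\<close> of cells with values below
  \<open>N\<close> and the restriction to \<open>T\<close>, as all removed cells carry
  \<open>N\<close>.\<close>

lemma fillings_step:
  assumes S: "Inv S" and N: "1 \<le> N" and M': "\<And>x. x \<in># M' \<Longrightarrow> 1 \<le> x \<and> x < N"
  shows "card (fillings S (replicate_mset a N + M')) = (\<Sum>T\<in>layers ok S a. card (fillings T M'))"
proof -
  let ?M = "replicate_mset a N + M'"
  let ?low = "\<lambda>\<kappa>. {c \<in> S. \<kappa> c < N}"
  let ?to = "\<lambda>\<kappa>. (?low \<kappa>, restrict \<kappa> (?low \<kappa>))"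
  \<comment> \<open>Fillings are extensional, so the inverse returns \<open>undefined\<close>
    outside \<open>S\<close>.\<close>
  let ?from = "\<lambda>(T, \<kappa>) c. if c \<in> T then \<kappa> c else if c \<in> S then N else (undefined :: nat)"
  have finS: "finite S" using S by (rule fin)
  have lt: "\<And>x. x \<in># M' \<Longrightarrow> x < N" using M' by blast
  have "bij_betw ?to (fillings S ?M) (SIGMA T:layers ok S a. fillings T M')"
  proof (rule bij_betw_byWitness[where f' = ?from])
    show "\<forall>\<kappa>\<in>fillings S ?M. ?from (?to \<kappa>) = \<kappa>"
    proof
      fix \<kappa> assume k: "\<kappa> \<in> fillings S ?M"
      have "\<kappa> c \<le> N" if "c \<in> S" for c
        using fillings_values[OF finS k that] M' by (auto split: if_splits simp: less_imp_le)
      moreover have "\<kappa> c = undefined" if "c \<notin> S" for c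
        using k F_funcset[of S] that by (auto simp: fillings_def)
      ultimately show "?from (?to \<kappa>) = \<kappa>"
        by (auto simp: fun_eq_iff dest: le_neq_implies_less)
    qed
    show "\<forall>x\<in>(SIGMA T:layers ok S a. fillings T M'). ?to (?from x) = x"
    proof
      fix x assume x: "x \<in> (SIGMA T:layers ok S a. fillings T M')"
      obtain T \<kappa> where xe: "x = (T, \<kappa>)" by fastforce
      with x have T: "T \<subseteq> S" and k: "\<kappa> \<in> fillings T M'" by (auto simp: layers_def)
      have "\<kappa> c < N" if "c \<in> T" for c
        using fillings_values[OF finite_subset[OF T finS] k that] lt by blast
      then have low: "?low (?from x) = T" using T by (auto simp: xe)
      have "restrict (?from x) T = \<kappa>"
        using k F_funcset[of T] by (auto simp: xe fillings_def fun_eq_iff restrict_def PiE_def extensional_def)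
      with low show "?to (?from x) = x" by (simp add: xe)
    qed
    show "?to ` fillings S ?M \<subseteq> (SIGMA T:layers ok S a. fillings T M')"
    proof
      fix x assume "x \<in> ?to ` fillings S ?M"
      then obtain \<kappa> where k: "\<kappa> \<in> fillings S ?M" and x: "x = ?to \<kappa>" by blast
      have kF: "\<kappa> \<in> F S" and im: "image_mset \<kappa> (mset_set S) = ?M"
        using k by (auto simp: fillings_def)
      have "\<kappa> \<in> S \<rightarrow>\<^sub>E {1..N}"
      proof -
        have "\<kappa> c \<in> {1..N}" if "c \<in> S" for c
          using fillings_values[OF finS k that] M' N by (auto split: if_splits simp: less_imp_le)
        then show ?thesis using kF F_funcset[of S] by (auto simp: PiE_def)
      qed
      then have "ok S (?low \<kappa>)" "restrict \<kappa> (?low \<kappa>) \<in> F (?low \<kappa>)"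
        using F_peel[OF S, of \<kappa> N] kF by auto
      moreover have "image_mset (restrict \<kappa> (?low \<kappa>)) (mset_set (?low \<kappa>)) = M'"
      proof -
        have "image_mset (restrict \<kappa> (?low \<kappa>)) (mset_set (?low \<kappa>)) = image_mset \<kappa> (mset_set (?low \<kappa>))"
          by (rule image_mset_cong) (use finS in auto)
        then show ?thesis using layer_sizes(2)[OF finS im lt] by simp
      qed
      ultimately show "x \<in> (SIGMA T:layers ok S a. fillings T M')"
        using layer_sizes(1)[OF finS im lt] by (auto simp: x layers_def fillings_def)
    qed
    show "?from ` (SIGMA T:layers ok S a. fillings T M') \<subseteq> fillings S ?M"
    proof
      fix \<tau> assume "\<tau> \<in> ?from ` (SIGMA T:layers ok S a. fillings T M')"
      then obtain T \<kappa> where T: "T \<in> layers ok S a" and k: "\<kappa> \<in> fillings T M'"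
        and t: "\<tau> = ?from (T, \<kappa>)" by blast
      have TS: "T \<subseteq> S" and ok: "ok S T" and cardT: "card (S - T) = a"
        using T by (auto simp: layers_def)
      have finT: "finite T" using TS finS finite_subset by blast
      have kF: "\<kappa> \<in> F T" and im: "image_mset \<kappa> (mset_set T) = M'"
        using k by (auto simp: fillings_def)
      have val: "1 \<le> \<kappa> c \<and> \<kappa> c < N" if "c \<in> T" for c
        using fillings_values[OF finT k that] M' by blast
      have low: "?low \<tau> = T" using TS val by (auto simp: t)
      have res: "restrict \<tau> T = \<kappa>"
        using kF F_funcset[of T] by (auto simp: t fun_eq_iff restrict_def PiE_def extensional_def)
      have "\<tau> \<in> S \<rightarrow>\<^sub>E {1..N}"
        using val TS N by (auto simp: t PiE_def extensional_def less_imp_le)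
      then have tF: "\<tau> \<in> F S" using F_peel[OF S, of \<tau> N] low res ok kF by simp
      have "mset_set S = mset_set (S - T) + mset_set T"
        by (metis Diff_disjoint Diff_partition TS add.commute finS finT finite_Diff mset_set_Union)
      moreover have "image_mset \<tau> (mset_set (S - T)) = image_mset (\<lambda>_. N) (mset_set (S - T))"
        by (rule image_mset_cong) (use finS in \<open>auto simp: t\<close>)
      moreover have "image_mset \<tau> (mset_set T) = image_mset \<kappa> (mset_set T)"
        by (rule image_mset_cong) (use finT in \<open>auto simp: t\<close>)
      ultimately have "image_mset \<tau> (mset_set S) = ?M"
        using cardT im by (simp add: image_mset_const_eq)
      with tF show "\<tau> \<in> fillings S ?M" by (simp add: fillings_def)
    qed
  qed
  then have "card (fillings S ?M) = card (SIGMA T:layers ok S a. fillings T M')"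
    by (rule bij_betw_same_card)
  also have "\<dots> = (\<Sum>T\<in>layers ok S a. card (fillings T M'))"
  proof (rule card_SigmaI)
    show "finite (layers ok S a)" using finS by (rule finite_layers)
    show "\<forall>T\<in>layers ok S a. finite (fillings T M')"
    proof
      fix T assume "T \<in> layers ok S a"
      then have finT: "finite T" using finS finite_subset by (auto simp: layers_def)
      \<comment> \<open>Values are confined to the support of the content, which is finite although
        \<open>{1..}\<close> is not.\<close>
      have "fillings T M' \<subseteq> T \<rightarrow>\<^sub>E set_mset M'"
        using fillings_values[OF finT] F_funcset[of T]
        by (auto simp: fillings_def PiE_def)
      then show "finite (fillings T M')"
        using finT by (meson finite_PiE finite_set_mset finite_subset)
    qed
  qed
  finally show ?thesis .
qed

text \<open>Induction splits off the largest colour. Applied to colourings and to tableaux, it turns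
  monomial coefficients into layer counts.\<close>

theorem card_fillings:
  "Inv S \<Longrightarrow> card (fillings S (content_mset as)) = peel_count ok S as"
proof (induction as arbitrary: S)
  case Nil
  have "fillings S {#} = (if S = {} then {\<lambda>_. undefined} else {})"
    using F_empty F_funcset[of "{}"] fin[OF Nil] by (auto simp: fillings_def mset_set_empty_iff)
  then show ?case by simp
next
  case (Cons a as)
  have "card (fillings S (content_mset (a # as))) = (\<Sum>T\<in>layers ok S a. card (fillings T (content_mset as)))"
    unfolding content_mset.simps
    by (rule fillings_step[OF Cons.prems]) (auto dest: content_mset_bounds)
  also have "\<dots> = (\<Sum>T\<in>layers ok S a. peel_count ok T as)"
    by (rule sum.cong) (use Cons inv in \<open>auto simp: layers_def\<close>)
  finally show ?case by simp
qed

text \<open>Grouping the chains \<open>S\<close>, \<open>T\<close>, \<open>U\<close> by their end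
  \<open>U\<close> leaves the number of middle sets \<open>T\<close> as weight, and
  \<open>exchange\<close> makes this weight symmetric in \<open>a\<close> and
  \<open>b\<close>.\<close>

lemma peel_count_swap:
  assumes S: "Inv S"
  shows "peel_count ok S (a # b # as) = peel_count ok S (b # a # as)"
proof -
  have finS: "finite S" using S by (rule fin)
  have *: "peel_count ok S (a # b # as)
      = (\<Sum>U\<in>Pow S. card {T \<in> layers ok S a. U \<in> layers ok T b} * peel_count ok U as)" for a b
  proof -
    \<comment> \<open>Letting \<open>U\<close> range over all subsets of \<open>S\<close>, with
      summand 0 where it is no layer of \<open>T\<close>, makes its range independent of
      \<open>T\<close>, so the sums can be interchanged.\<close>
    have "peel_count ok S (a # b # as)
        = (\<Sum>T\<in>layers ok S a. \<Sum>U\<in>Pow S. if U \<in> layers ok T b then peel_count ok U as else 0)"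
    proof (simp, rule sum.cong[OF refl])
      fix T assume "T \<in> layers ok S a"
      then have "layers ok T b = {U \<in> Pow S. U \<in> layers ok T b}" by (auto simp: layers_def)
      then show "(\<Sum>T\<in>layers ok T b. peel_count ok T as)
          = (\<Sum>U\<in>Pow S. if U \<in> layers ok T b then peel_count ok U as else 0)"
        using finS sum.inter_filter[of "Pow S" "\<lambda>U. peel_count ok U as" "\<lambda>U. U \<in> layers ok T b"] by simp
    qed
    also have "\<dots> = (\<Sum>U\<in>Pow S. \<Sum>T\<in>layers ok S a. if U \<in> layers ok T b then peel_count ok U as else 0)"
      by (rule sum.swap)
    also have "\<dots> = (\<Sum>U\<in>Pow S. card {T \<in> layers ok S a. U \<in> layers ok T b} * peel_count ok U as)"
      by (rule sum.cong[OF refl]) (simp add: finite_layers[OF finS] flip: sum.inter_filter)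
    finally show ?thesis .
  qed
  show ?thesis unfolding * using exchange[OF S] by (intro sum.cong) auto
qed

lemma peel_count_Cons_cong:
  assumes "Inv S" "\<And>T. Inv T \<Longrightarrow> peel_count ok T as = peel_count ok T bs"
  shows "peel_count ok S (a # as) = peel_count ok S (a # bs)"
  using assms inv by (auto simp: layers_def intro!: sum.cong)

lemma peel_count_move:
  "Inv S \<Longrightarrow> peel_count ok S (xs @ a # ys) = peel_count ok S (a # xs @ ys)"
proof (induction xs arbitrary: S)
  case (Cons x xs)
  then show ?case
    using peel_count_Cons_cong[of S "xs @ a # ys" "a # xs @ ys" x] peel_count_swap[of S x a "xs @ ys"]
    by simp
qed simp

text \<open>Adjacent swaps suffice: the first entry of \<open>as\<close> is located in
  \<open>bs\<close> and moved to the front there.\<close>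

theorem peel_count_perm:
  "Inv S \<Longrightarrow> mset as = mset bs \<Longrightarrow> peel_count ok S as = peel_count ok S bs"
proof (induction as arbitrary: S bs)
  case (Cons a as)
  then obtain xs ys where bs: "bs = xs @ a # ys"
    by (metis list.set_intros(1) mset_eq_setD split_list)
  with Cons.prems have "mset as = mset (xs @ ys)" by simp
  then have "peel_count ok S (a # as) = peel_count ok S (a # xs @ ys)"
    by (intro peel_count_Cons_cong Cons.prems Cons.IH)
  then show ?case using peel_count_move[OF Cons.prems(1)] bs by simp
qed simp

lemma layers_0: "Inv S \<Longrightarrow> layers ok S 0 = {S}"
  using ok_refl fin by (auto simp: layers_def)

lemma peel_count_drop_zeros:
  "Inv S \<Longrightarrow> peel_count ok S (filter (\<lambda>a. a \<noteq> 0) as) = peel_count ok S as"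
proof (induction as arbitrary: S)
  case (Cons a as)
  then show ?case
    using layers_0[OF Cons.prems] inv by (auto simp: layers_def intro!: sum.cong)
qed simp

lemma peel_count_sum: "Inv S \<Longrightarrow> peel_count ok S as \<noteq> 0 \<Longrightarrow> card S = sum_list as"
proof (induction as arbitrary: S)
  case Nil
  then show ?case by (auto split: if_splits)
next
  case (Cons a as)
  then obtain T where T: "T \<in> layers ok S a" "peel_count ok T as \<noteq> 0"
    by (metis peel_count.simps(2) sum.not_neutral_contains_not_neutral)
  then have TS: "T \<subseteq> S" and "ok S T" and c: "card (S - T) = a" by (auto simp: layers_def)
  then have "card T = sum_list as" using Cons.IH T(2) inv Cons.prems(1) by blast
  moreover have "card S = card (S - T) + card T"
    using TS fin[OF Cons.prems(1)] by (metis Diff_disjoint Diff_partition Int_commute add.commute card_Un_disjoint finite_Diff finite_subset)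
  ultimately show ?case using c by simp
qed

end

section \<open>Proper colourings peeled by stable sets\<close>

section \<open>Colourings\<close>

definition colour_layer :: "'a set set \<Rightarrow> 'a set \<Rightarrow> 'a set \<Rightarrow> bool" where
  "colour_layer E S T \<longleftrightarrow> (\<forall>v\<in>S - T. \<forall>w\<in>S - T. {v, w} \<notin> E)"

definition colourings_on :: "'a set set \<Rightarrow> 'a set \<Rightarrow> ('a \<Rightarrow> nat) set" where
  "colourings_on E S = {\<kappa> \<in> S \<rightarrow>\<^sub>E {1..}. \<forall>v\<in>S. \<forall>w\<in>S. {v, w} \<in> E \<longrightarrow> \<kappa> v \<noteq> \<kappa> w}"

text \<open>Stability of a removed set does not depend on what it is removed from, so consecutive
  colour classes can trade places.\<close>

interpretation colouring: peeling finite "colour_layer E" "colourings_on E" for E :: "'a set set"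
proof
  fix S :: "'a set" and \<kappa> :: "'a \<Rightarrow> nat" and N
  assume k: "\<kappa> \<in> S \<rightarrow>\<^sub>E {1..N}"
  let ?T = "{c \<in> S. \<kappa> c < N}"
  have top: "\<kappa> c = N" if "c \<in> S - ?T" for c using k that by force
  have res: "restrict \<kappa> ?T \<in> ?T \<rightarrow>\<^sub>E {1..}" using k by auto
  show "\<kappa> \<in> colourings_on E S \<longleftrightarrow>
      colour_layer E S ?T \<and> restrict \<kappa> ?T \<in> colourings_on E ?T"
  proof (intro iffI conjI)
    assume "\<kappa> \<in> colourings_on E S"
    then have ne: "\<kappa> v \<noteq> \<kappa> w" if "{v, w} \<in> E" "v \<in> S" "w \<in> S" for v w
      using that by (auto simp: colourings_on_def)
    show "colour_layer E S ?T"
      unfolding colour_layer_def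
    proof (intro ballI notI)
      fix v w assume "v \<in> S - ?T" "w \<in> S - ?T" "{v, w} \<in> E"
      then show False using ne[of v w] top[of v] top[of w] by (metis DiffD1)
    qed
    show "restrict \<kappa> ?T \<in> colourings_on E ?T"
      using ne res by (simp add: colourings_on_def)
  next
    assume a: "colour_layer E S ?T \<and> restrict \<kappa> ?T \<in> colourings_on E ?T"
    have "\<kappa> v \<noteq> \<kappa> w" if e: "{v, w} \<in> E" and v: "v \<in> S" and w: "w \<in> S" for v w
    proof (cases "v \<in> ?T \<longleftrightarrow> w \<in> ?T")
      case True
      then show ?thesis
        using a e v w by (cases "v \<in> ?T") (auto simp: colourings_on_def colour_layer_def)
    next
      case False
      then show ?thesis using v w by auto
    qed
    with k show "\<kappa> \<in> colourings_on E S" by (auto simp: colourings_on_def PiE_def)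
  qed
next
  fix S U :: "'a set" and a b
  assume S: "finite S" and U: "U \<subseteq> S"
  let ?X = "\<lambda>a b. {T \<in> layers (colour_layer E) S a. U \<in> layers (colour_layer E) T b}"
  \<comment> \<open>Removing \<open>T - U\<close> first and \<open>S - T\<close> second leaves
    \<open>U \<union> (S - T)\<close> in between.\<close>
  have flip: "U \<union> (S - T) \<in> ?X b a" if T: "T \<in> ?X a b" for T a b
  proof -
    have "S - (U \<union> (S - T)) = T - U" "U \<union> (S - T) - U = S - T"
      using T U by (auto simp: layers_def)
    then show ?thesis using T U by (auto simp: layers_def colour_layer_def)
  qed
  have "bij_betw (\<lambda>T. U \<union> (S - T)) (?X a b) (?X b a)"
  proof (rule bij_betw_byWitness[where f' = "\<lambda>T. U \<union> (S - T)"])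
    show "\<forall>T\<in>?X a b. U \<union> (S - (U \<union> (S - T))) = T" "\<forall>T\<in>?X b a. U \<union> (S - (U \<union> (S - T))) = T"
      using U by (auto simp: layers_def)
  qed (use flip in blast)+
  then show "card (?X a b) = card (?X b a)" by (rule bij_betw_same_card)
qed (auto simp: colourings_on_def colour_layer_def intro: finite_subset)

lemma chromatic_content:
  assumes "finite (verts G)"
  shows "chromatic_symmetric_function G (content_mset as) = int (peel_count (colour_layer (edges G)) (verts G) as)"
proof -
  have "proper_colourings G = colourings_on (edges G) (verts G)"
    by (simp add: proper_colourings_def colourings_on_def)
  then show ?thesis
    using colouring.card_fillings[OF assms, of "edges G" as]
    by (simp add: chromatic_symmetric_function_def colouring.fillings_def)
qed

section \<open>Shapes, horizontal strips and the Bender-Knuth exchange\<close>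

section \<open>Diagrams\<close>

definition diagram :: "(nat \<Rightarrow> nat) \<Rightarrow> (nat \<times> nat) set" where
  "diagram p = {(i, j). j < p i}"

text \<open>For antitone \<open>p\<close> and \<open>q\<close> this says that the skew shape p/q is
  a horizontal strip.\<close>

definition interlaces :: "(nat \<Rightarrow> nat) \<Rightarrow> (nat \<Rightarrow> nat) \<Rightarrow> bool" where
  "interlaces p q \<longleftrightarrow> (\<forall>i. p (Suc i) \<le> q i \<and> q i \<le> p i)"

definition is_shape :: "(nat \<times> nat) set \<Rightarrow> bool" where
  "is_shape S \<longleftrightarrow> (\<exists>p. antimono p \<and> finite (diagram p) \<and> S = diagram p)"

text \<open>The last clause keeps each cell directly above a cell of \<open>S\<close>, so a column
  of a diagram loses at most its lowest cell.\<close>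

definition tableau_layer :: "(nat \<times> nat) set \<Rightarrow> (nat \<times> nat) set \<Rightarrow> bool" where
  "tableau_layer S T \<longleftrightarrow> (\<exists>q. antimono q \<and> T = diagram q) \<and> (\<forall>i j. (Suc i, j) \<in> S \<longrightarrow> (i, j) \<in> T)"

definition tableaux_on :: "(nat \<times> nat) set \<Rightarrow> (nat \<times> nat \<Rightarrow> nat) set" where
  "tableaux_on S = {T \<in> S \<rightarrow>\<^sub>E {1..}.
     (\<forall>i j. (i, j) \<in> S \<longrightarrow> (i, Suc j) \<in> S \<longrightarrow> T (i, j) \<le> T (i, Suc j)) \<and>
     (\<forall>i j. (i, j) \<in> S \<longrightarrow> (Suc i, j) \<in> S \<longrightarrow> T (i, j) < T (Suc i, j))}"

lemma mem_diagram [simp]: "(i, j) \<in> diagram p \<longleftrightarrow> j < p i"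
  by (simp add: diagram_def)

lemma diagram_subset_iff: "diagram q \<subseteq> diagram p \<longleftrightarrow> (\<forall>i. q i \<le> p i)"
  by (auto simp: subset_iff) (meson leI less_irrefl, meson less_le_trans)

lemma diagram_inject: "diagram q = diagram p \<longleftrightarrow> q = p"
  by (metis antisym diagram_subset_iff ext order_refl)

lemma card_diagram:
  assumes "\<And>i. L \<le> i \<Longrightarrow> p i = 0" shows "card (diagram p) = sum p {..<L}" "finite (diagram p)"
proof -
  have *: "diagram p = (SIGMA i:{..<L}. {..<p i})"
    using assms by (auto simp: not_less) (metis leI less_zeroE)
  show "card (diagram p) = sum p {..<L}" "finite (diagram p)"
    unfolding * by (auto simp: card_SigmaI)
qed

lemma finite_diagram_bound:
  assumes "antimono p" "finite (diagram p)" obtains L where "\<And>i. L \<le> i \<Longrightarrow> p i = 0"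
proof -
  have "(\<lambda>i. (i, 0::nat)) ` {i. p i \<noteq> 0} \<subseteq> diagram p" by auto
  then have "finite {i. p i \<noteq> 0}"
    using assms(2) by (meson finite_imageD finite_subset inj_onI prod.inject)
  then obtain L where "\<forall>i\<in>{i. p i \<noteq> 0}. i < L" by (meson finite_nat_set_iff_bounded)
  then show ?thesis using that by (metis leD mem_Collect_eq)
qed

lemma interlaces_antimono: "interlaces p q \<Longrightarrow> antimono q"
  by (metis antimonoI interlaces_def le_trans lift_Suc_antimono_le)

text \<open>The column clause becomes \<open>p (Suc i) \<le> q i\<close> and inclusion becomes
  \<open>q i \<le> p i\<close>. Together they make \<open>q\<close> antitone, as
  \<open>q (Suc i) \<le> p (Suc i) \<le> q i\<close>.\<close>

lemma tableau_layer_iff: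
  "tableau_layer (diagram p) (diagram q) \<and> diagram q \<subseteq> diagram p \<longleftrightarrow> interlaces p q"
proof -
  have "(\<forall>i j. (Suc i, j) \<in> diagram p \<longrightarrow> (i, j) \<in> diagram q) \<longleftrightarrow> (\<forall>i. p (Suc i) \<le> q i)"
    unfolding mem_diagram by (meson leI less_irrefl less_le_trans)
  then show ?thesis
    using interlaces_antimono[of p q]
    by (auto simp: tableau_layer_def diagram_subset_iff interlaces_def)
qed

lemma tableau_layers:
  assumes "finite (diagram p)"
  shows "layers tableau_layer (diagram p) a
    = diagram ` {q. interlaces p q \<and> card (diagram q) + a = card (diagram p)}"
proof -
  have c: "card (diagram p - diagram q) = a \<longleftrightarrow> card (diagram q) + a = card (diagram p)"
    if "interlaces p q" for q
  proof -
    have "diagram q \<subseteq> diagram p" using that tableau_layer_iff by blast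
    then show ?thesis
      using assms card_mono[of "diagram p" "diagram q"] by (auto simp: card_Diff_subset finite_subset)
  qed
  have "T \<in> layers tableau_layer (diagram p) a \<longleftrightarrow>
      T \<in> diagram ` {q. interlaces p q \<and> card (diagram q) + a = card (diagram p)}" for T
  proof
    assume T: "T \<in> layers tableau_layer (diagram p) a"
    then obtain q where q: "T = diagram q" by (auto simp: layers_def tableau_layer_def)
    then have "interlaces p q" using T tableau_layer_iff by (auto simp: layers_def)
    then show "T \<in> diagram ` {q. interlaces p q \<and> card (diagram q) + a = card (diagram p)}"
      using T c q by (auto simp: layers_def)
  next
    assume "T \<in> diagram ` {q. interlaces p q \<and> card (diagram q) + a = card (diagram p)}"
    then show "T \<in> layers tableau_layer (diagram p) a"
      using c tableau_layer_iff unfolding layers_def by blast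
  qed
  then show ?thesis by blast
qed

text \<open>In Gelfand--Tsetlin form, the involution reflects each row length of the intermediate shape in
  the interval of its admissible values.\<close>

definition bender_knuth :: "(nat \<Rightarrow> nat) \<Rightarrow> (nat \<Rightarrow> nat) \<Rightarrow> (nat \<Rightarrow> nat) \<Rightarrow> nat \<Rightarrow> nat" where
  "bender_knuth p r q i =
     max (r i) (p (Suc i)) + (if i = 0 then p 0 else min (p i) (r (i - 1))) - q i"

text \<open>Fixing \<open>p\<close> and \<open>r\<close> confines each \<open>q i\<close> to an
  interval that does not depend on the other rows of \<open>q\<close>. Reflection in it is an
  involution that keeps both strip conditions. Row 0 has no row above it, so its upper end is
  \<open>p 0\<close>. Truncated subtraction is exact because \<open>q i\<close> does not exceed the
  upper end.\<close>

lemma bender_knuth_props: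
  assumes pq: "interlaces p q" and qr: "interlaces q r"
  shows "interlaces p (bender_knuth p r q)" "interlaces (bender_knuth p r q) r"
    and "bender_knuth p r (bender_knuth p r q) = q"
    and "q i + bender_knuth p r q i = max (r i) (p (Suc i)) + (if i = 0 then p 0 else min (p i) (r (i - 1)))"
proof -
  have lo: "max (r i) (p (Suc i)) \<le> q i" for i
    using pq qr by (auto simp: interlaces_def)
  have hi: "q i \<le> (if i = 0 then p 0 else min (p i) (r (i - 1)))" for i
    using pq qr by (cases i) (auto simp: interlaces_def)
  have b1: "max (r i) (p (Suc i)) \<le> bender_knuth p r q i" for i
    using lo[of i] hi[of i] unfolding bender_knuth_def by linarith
  have b2: "bender_knuth p r q i \<le> (if i = 0 then p 0 else min (p i) (r (i - 1)))" for i
    using lo[of i] hi[of i] unfolding bender_knuth_def by linarith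
  show "q i + bender_knuth p r q i = max (r i) (p (Suc i)) + (if i = 0 then p 0 else min (p i) (r (i - 1)))"
    using hi[of i] unfolding bender_knuth_def by linarith
  show "bender_knuth p r (bender_knuth p r q) = q"
  proof
    fix i show "bender_knuth p r (bender_knuth p r q) i = q i"
      using lo[of i] hi[of i] unfolding bender_knuth_def by linarith
  qed
  show "interlaces p (bender_knuth p r q)"
    unfolding interlaces_def
  proof
    fix i show "p (Suc i) \<le> bender_knuth p r q i \<and> bender_knuth p r q i \<le> p i"
      using b1[of i] b2[of i] by (auto split: if_splits)
  qed
  show "interlaces (bender_knuth p r q) r"
    unfolding interlaces_def
  proof
    fix i show "bender_knuth p r q (Suc i) \<le> r i \<and> r i \<le> bender_knuth p r q i"
      using b1[of i] b2[of "Suc i"] by simp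
  qed
qed

text \<open>The lower end in row \<open>i\<close> and the upper end in row \<open>Suc i\<close> are
  the maximum and the minimum of the same numbers \<open>r i\<close> and \<open>p (Suc i)\<close>,
  so all ends add up to the sizes of \<open>p\<close> and \<open>r\<close>. Hence the two strip
  sizes are interchanged.\<close>

lemma card_bender_knuth:
  assumes pq: "interlaces p q" and qr: "interlaces q r" and p: "antimono p" "finite (diagram p)"
  shows "card (diagram q) + card (diagram (bender_knuth p r q)) = card (diagram p) + card (diagram r)"
proof -
  obtain L where L: "\<And>i. L \<le> i \<Longrightarrow> p i = 0" using finite_diagram_bound[OF p] by blast
  let ?q' = "bender_knuth p r q"
  have z: "q i = 0 \<and> ?q' i = 0 \<and> r i = 0" if "L \<le> i" for i
    using L[OF that] bender_knuth_props(1,2)[OF pq qr] pq qr by (auto simp: interlaces_def) (metis le_zero_eq)+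
  have "card (diagram q) + card (diagram ?q') = (\<Sum>i<Suc L. q i + ?q' i)"
    using z by (subst (1 2) card_diagram(1)[of "Suc L"]) (auto simp: sum.distrib)
  also have "\<dots> = (\<Sum>i<Suc L. max (r i) (p (Suc i))) + (\<Sum>i<Suc L. if i = 0 then p 0 else min (p i) (r (i - 1)))"
    unfolding bender_knuth_props(4)[OF pq qr] by (rule sum.distrib)
  also have "(\<Sum>i<Suc L. max (r i) (p (Suc i))) = (\<Sum>i<L. max (r i) (p (Suc i)))"
    using z[of L] L[of "Suc L"] by simp
  also have "(\<Sum>i<Suc L. if i = 0 then p 0 else min (p i) (r (i - 1))) = p 0 + (\<Sum>i<L. min (p (Suc i)) (r i))"
    by (subst sum.lessThan_Suc_shift) simp
  also have "(\<Sum>i<L. max (r i) (p (Suc i))) + (p 0 + (\<Sum>i<L. min (p (Suc i)) (r i)))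
      = (p 0 + (\<Sum>i<L. p (Suc i))) + (\<Sum>i<L. r i)"
    by (simp add: max_def min_def flip: sum.distrib) (auto intro: sum.cong)
  also have "p 0 + (\<Sum>i<L. p (Suc i)) = (\<Sum>i<Suc L. p i)"
    by (simp only: sum.lessThan_Suc_shift)
  also have "\<dots> = card (diagram p)" using L by (subst card_diagram(1)[of "Suc L"]) auto
  also have "(\<Sum>i<L. r i) = card (diagram r)" using z by (subst card_diagram(1)[of L]) auto
  finally show ?thesis .
qed

text \<open>Chains from \<open>S\<close> to a diagram \<open>U\<close> correspond to the row lengths
  \<open>q\<close> in the middle, on which \<open>bender_knuth\<close> is a bijection exchanging the
  strip sizes. If \<open>U\<close> is no diagram, both sides count nothing.\<close>

lemma tableau_exchange:
  assumes "is_shape S"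
  shows "card {T \<in> layers tableau_layer S a. U \<in> layers tableau_layer T b}
       = card {T \<in> layers tableau_layer S b. U \<in> layers tableau_layer T a}"
proof (cases "\<exists>r. U = diagram r")
  case False
  then have "U \<notin> layers tableau_layer T b" for T b by (auto simp: layers_def tableau_layer_def)
  then show ?thesis by simp
next
  case True
  then obtain r where r: "U = diagram r" by blast
  from assms obtain p where p: "antimono p" "finite (diagram p)" "S = diagram p"
    by (auto simp: is_shape_def)
  let ?Q = "\<lambda>a b. {q. interlaces p q \<and> interlaces q r \<and> card (diagram q) + a = card (diagram p)
    \<and> card (diagram r) + b = card (diagram q)}"
  have *: "card {T \<in> layers tableau_layer S a. U \<in> layers tableau_layer T b} = card (?Q a b)" for a b
  proof -
    have "finite (diagram q)" if "interlaces p q" for q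
      using that p(2) tableau_layer_iff by (meson finite_subset)
    then have "{T \<in> layers tableau_layer S a. U \<in> layers tableau_layer T b} = diagram ` ?Q a b"
      unfolding p(3) r tableau_layers[OF p(2)]
      by (auto simp: tableau_layers diagram_inject)
    moreover have "inj_on diagram (?Q a b)" by (auto simp: inj_on_def diagram_inject)
    ultimately show ?thesis by (simp add: card_image)
  qed
  have bk: "bender_knuth p r ` ?Q a b \<subseteq> ?Q b a" for a b
  proof
    fix q' assume "q' \<in> bender_knuth p r ` ?Q a b"
    then obtain q where q: "q \<in> ?Q a b" "q' = bender_knuth p r q" by blast
    then show "q' \<in> ?Q b a"
      using bender_knuth_props(1,2)[of p q r] card_bender_knuth[OF _ _ p(1,2), of q r] by auto
  qed
  have "bij_betw (bender_knuth p r) (?Q a b) (?Q b a)"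
    by (rule bij_betw_byWitness[OF _ _ bk bk]) (auto simp: bender_knuth_props(3))
  then show ?thesis unfolding * by (rule bij_betw_same_card)
qed

text \<open>Weakly increasing rows make the entries smaller than \<open>N\<close> an initial segment
  of each row; strict columns with entries at most \<open>N\<close> force every cell above another
  cell into \<open>L\<close>. Conversely, all entries outside \<open>L\<close> equal
  \<open>N\<close>, and the cell above such an entry lies in \<open>L\<close>.\<close>

lemma tableau_peel:
  assumes p: "antimono p" and T: "T \<in> diagram p \<rightarrow>\<^sub>E {1..N}"
  defines "L \<equiv> {c \<in> diagram p. T c < N}"
  shows "T \<in> tableaux_on (diagram p) \<longleftrightarrow> tableau_layer (diagram p) L \<and> restrict T L \<in> tableaux_on L"
proof
  have le: "T c \<le> N" if "c \<in> diagram p" for c using T that by auto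
  assume ssyt: "T \<in> tableaux_on (diagram p)"
  have row: "T (i, j) \<le> T (i, Suc j)" if "Suc j < p i" for i j
    using ssyt that by (auto simp: tableaux_on_def)
  have col: "T (i, j) < T (Suc i, j)" if "j < p (Suc i)" for i j
  proof -
    have "j < p i" using that antimonoD[OF p, of i "Suc i"] by simp
    then show ?thesis using ssyt that by (auto simp: tableaux_on_def)
  qed
  have row': "T (i, j) \<le> T (i, k)" if "j \<le> k" "k < p i" for i j k
    using that
  proof (induction k rule: dec_induct)
    case (step k)
    then show ?case using row[of k i] by simp
  qed simp
  define q where "q i = card {j. (i, j) \<in> L}" for i
  have q: "{j. (i, j) \<in> L} = {..<q i}" for i
  proof -
    have fin: "finite {j. (i, j) \<in> L}"
      by (rule finite_subset[of _ "{..<p i}"]) (auto simp: L_def)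
    have down: "k \<in> {j. (i, j) \<in> L}" if "j \<in> {j. (i, j) \<in> L}" "k \<le> j" for j k
      using that row'[of k j i] by (auto simp: L_def)
    show ?thesis
      unfolding q_def
    proof (rule card_subset_eq[symmetric, OF fin])
      \<comment> \<open>A downward closed set missing \<open>k\<close> lies in \<open>{..<k}\<close>
        and so has at most \<open>k\<close> elements.\<close>
      show "{..<card {j. (i, j) \<in> L}} \<subseteq> {j. (i, j) \<in> L}"
      proof (rule ccontr)
        assume "\<not> ?thesis"
        then obtain k where k: "k < card {j. (i, j) \<in> L}" "k \<notin> {j. (i, j) \<in> L}" by blast
        then have "{j. (i, j) \<in> L} \<subseteq> {..<k}" using down by (metis leI lessThan_iff subsetI)
        then have "card {j. (i, j) \<in> L} \<le> k" using card_mono[of "{..<k}"] by fastforce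
        then show False using k by simp
      qed
    qed simp
  qed
  then have Lq: "L = diagram q" by (auto simp: set_eq_iff)
  have up: "(i, j) \<in> L" if "(Suc i, j) \<in> diagram p" for i j
  proof -
    have "j < p i" using that antimonoD[OF p, of i "Suc i"] by simp
    moreover have "T (i, j) < N" using col[of j i] le[of "(Suc i, j)"] that by simp
    ultimately show ?thesis by (simp add: L_def)
  qed
  have "L \<subseteq> diagram p" by (auto simp: L_def)
  then have "interlaces p q"
    unfolding Lq interlaces_def diagram_subset_iff
    using up unfolding Lq by (metis leI less_irrefl mem_diagram)
  then have "tableau_layer (diagram p) L" using tableau_layer_iff Lq by blast
  moreover have "restrict T L \<in> tableaux_on L"
    using ssyt \<open>L \<subseteq> diagram p\<close> row col by (auto simp: tableaux_on_def subset_iff)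
  ultimately show "tableau_layer (diagram p) L \<and> restrict T L \<in> tableaux_on L" ..
next
  assume a: "tableau_layer (diagram p) L \<and> restrict T L \<in> tableaux_on L"
  then obtain q where q: "antimono q" "L = diagram q" by (auto simp: tableau_layer_def)
  have up: "j < q i" if "j < p (Suc i)" for i j using a that q by (auto simp: tableau_layer_def)
  have lt: "T (i, j) < N" if "j < q i" for i j using that q(2) by (auto simp: L_def set_eq_iff)
  have ge: "T (i, j) = N" if "j < p i" "\<not> j < q i" for i j
  proof -
    have "(i, j) \<notin> L" using that q by simp
    moreover have "T (i, j) \<le> N" using T that by auto
    ultimately show ?thesis using that by (auto simp: L_def)
  qed
  have row: "T (i, j) \<le> T (i, Suc j)" if "Suc j < q i" for i j
    using a that q(2) by (auto simp: tableaux_on_def)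
  have col: "T (i, j) < T (Suc i, j)" if "j < q (Suc i)" "j < q i" for i j
    using a that q(2) by (auto simp: tableaux_on_def)
  have "T (i, j) \<le> T (i, Suc j)" if "Suc j < p i" for i j
  proof (cases "Suc j < q i")
    case False
    then have "T (i, Suc j) = N" using ge that by blast
    moreover have "T (i, j) \<le> N" using T that by auto
    ultimately show ?thesis by simp
  qed (rule row)
  moreover have "T (i, j) < T (Suc i, j)" if "j < p (Suc i)" for i j
  proof (cases "j < q (Suc i)")
    case False
    then show ?thesis using ge[of j "Suc i"] that lt up by simp
  qed (use col up that in blast)
  moreover have "T \<in> diagram p \<rightarrow>\<^sub>E {1..}" using T by (auto simp: PiE_def)
  ultimately show "T \<in> tableaux_on (diagram p)" by (auto simp: tableaux_on_def)
qed

interpretation tableau: peeling is_shape tableau_layer tableaux_on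
proof
  show "is_shape T" if "is_shape S" "T \<subseteq> S" "tableau_layer S T" for S T
    using that by (auto simp: is_shape_def tableau_layer_def intro: finite_subset)
  show "tableau_layer S S" if S: "is_shape S" for S
  proof -
    obtain p where p: "antimono p" "S = diagram p" using S by (auto simp: is_shape_def)
    then have "interlaces p p" by (auto simp: interlaces_def antimono_def)
    then show ?thesis using tableau_layer_iff p by blast
  qed
  show "T \<in> tableaux_on S \<longleftrightarrow> tableau_layer S {c \<in> S. T c < N} \<and>
      restrict T {c \<in> S. T c < N} \<in> tableaux_on {c \<in> S. T c < N}"
    if "is_shape S" "T \<in> S \<rightarrow>\<^sub>E {1..N}" for S T N
    using that tableau_peel by (auto simp: is_shape_def)
qed (simp_all add: tableau_exchange, auto simp: is_shape_def tableaux_on_def)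

section \<open>Kostka numbers and their triangularity\<close>

section \<open>Kostka numbers\<close>

definition rows :: "nat list \<Rightarrow> nat \<Rightarrow> nat" where
  "rows p i = (if i < length p then p ! i else 0)"

definition kostka :: "nat list \<Rightarrow> nat list \<Rightarrow> nat" where
  "kostka p as = peel_count tableau_layer (diagram (rows p)) as"

lemma rows_Nil [simp]: "rows [] = (\<lambda>_. 0)"
  by (simp add: rows_def fun_eq_iff)

lemma rows_Cons_0 [simp]: "rows (x # p) 0 = x"
  by (simp add: rows_def)

lemma rows_Cons_Suc [simp]: "rows (x # p) (Suc i) = rows p i"
  by (simp add: rows_def)

lemma antimono_rows:
  assumes "sorted_wrt (\<ge>) p" shows "antimono (rows p)"
  unfolding antimono_def rows_def
  using assms by (auto simp: sorted_wrt_iff_nth_less le_less)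

lemma finite_diagram_rows: "finite (diagram (rows p))"
  by (rule card_diagram(2)[of "length p"]) (simp add: rows_def)

lemma card_diagram_rows: "card (diagram (rows p)) = sum_list p"
  by (subst card_diagram(1)[of "length p"]) (auto simp: rows_def sum_list_sum_nth atLeast0LessThan)

lemma is_shape_rows: "sorted_wrt (\<ge>) p \<Longrightarrow> is_shape (diagram (rows p))"
  using antimono_rows finite_diagram_rows by (auto simp: is_shape_def)

lemma young_diagram_rows: "young_diagram p = diagram (rows p)"
  by (auto simp: young_diagram_def rows_def split: if_splits)

lemma schur_content:
  assumes "is_partition p"
  shows "schur_function p (content_mset as) = int (kostka p as)"
proof -
  have "semistandard_tableaux p = tableaux_on (young_diagram p)"
    by (simp add: semistandard_tableaux_def tableaux_on_def)
  then show ?thesis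
    using tableau.card_fillings[OF is_shape_rows, of p as] assms
    by (simp add: schur_function_def tableau.fillings_def kostka_def is_partition_def
        flip: young_diagram_rows)
qed

lemma card_diagram_first_row:
  assumes "antimono p" "finite (diagram p)"
  shows "card (diagram p) = p 0 + card (diagram (\<lambda>i. p (Suc i)))"
proof -
  obtain L where L: "\<And>i. L \<le> i \<Longrightarrow> p i = 0" using finite_diagram_bound[OF assms] by blast
  have "card (diagram p) = (\<Sum>i<Suc L. p i)" using L by (intro card_diagram(1)) simp
  also have "\<dots> = p 0 + (\<Sum>i<L. p (Suc i))" by (rule sum.lessThan_Suc_shift)
  also have "(\<Sum>i<L. p (Suc i)) = card (diagram (\<lambda>i. p (Suc i)))"
    using L by (intro card_diagram(1)[symmetric]) simp
  finally show ?thesis .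
qed

text \<open>Every \<open>q\<close> interlacing with \<open>p\<close> contains \<open>p\<close>
  without its first row, since \<open>p (Suc i) \<le> q i\<close>. So a strip has at most
  \<open>p 0\<close> cells, and only this smallest \<open>q\<close> attains the bound.\<close>

lemma tableau_layers_first_row:
  assumes p: "antimono p" "finite (diagram p)"
  shows "p 0 < a \<Longrightarrow> layers tableau_layer (diagram p) a = {}"
    and "layers tableau_layer (diagram p) (p 0) = {diagram (\<lambda>i. p (Suc i))}"
proof -
  let ?t = "\<lambda>i. p (Suc i)"
  have sub: "diagram ?t \<subseteq> diagram q" "finite (diagram q)" if "interlaces p q" for q
    using that p(2) tableau_layer_iff[of p q] finite_subset[of "diagram q" "diagram p"]
    by (auto simp: diagram_subset_iff interlaces_def)
  show "layers tableau_layer (diagram p) a = {}" if "p 0 < a"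
    using that card_mono[OF sub(2,1)] unfolding tableau_layers[OF p(2)] card_diagram_first_row[OF p]
    by fastforce
  have "interlaces p ?t" using p(1) by (auto simp: interlaces_def antimono_def)
  moreover have "q = ?t" if "interlaces p q" "card (diagram q) + p 0 = card (diagram p)" for q
    using card_subset_eq[OF sub(2,1), of q] that card_diagram_first_row[OF p]
    by (auto simp: diagram_inject)
  ultimately show "layers tableau_layer (diagram p) (p 0) = {diagram ?t}"
    unfolding tableau_layers[OF p(2)] using card_diagram_first_row[OF p] by (auto simp: add.commute)
qed

text \<open>A strip as long as the first row is forced, so equal first parts of shape and content
  cancel. This gives both the diagonal values 1 and triangularity.\<close>

lemma kostka_first_row: "sorted_wrt (\<ge>) (x # p) \<Longrightarrow> kostka (x # p) (x # as) = kostka p as"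
  using tableau_layers_first_row(2)[OF antimono_rows finite_diagram_rows, of "x # p"]
  by (simp add: kostka_def)

lemma kostka_first_part:
  "sorted_wrt (\<ge>) p \<Longrightarrow> kostka p (a # as) \<noteq> 0 \<Longrightarrow> a \<le> rows p 0"
  using tableau_layers_first_row(1)[OF antimono_rows finite_diagram_rows, of p a]
  by (auto simp: kostka_def intro: leI)

lemma kostka_self: "sorted_wrt (\<ge>) p \<Longrightarrow> kostka p p = 1"
proof (induction p)
  case Nil
  then show ?case by (simp add: kostka_def diagram_def)
next
  case (Cons x p)
  then show ?case using kostka_first_row[of x p p] by simp
qed

text \<open>If the first part of the content is smaller than that of the shape, the lexicographic
  comparison is decided; equal first parts cancel and the induction continues.\<close>

lemma kostka_triangular:
  "is_partition p \<Longrightarrow> 0 \<notin> set m \<Longrightarrow> kostka p m \<noteq> 0 \<Longrightarrow> m \<le> p"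
proof (induction m arbitrary: p)
  case (Cons a m)
  have a: "a \<le> rows p 0" using kostka_first_part Cons.prems by (auto simp: is_partition_def)
  then obtain x p' where p: "p = x # p'" using Cons.prems(2) by (cases p) auto
  show ?case
  proof (cases "a = x")
    case True
    then have "kostka p' m \<noteq> 0"
      using Cons.prems kostka_first_row[of x p' m] by (auto simp: p is_partition_def)
    then have "m \<le> p'" using Cons by (auto simp: p is_partition_def)
    then show ?thesis using True p by simp
  qed (use a p in simp)
qed simp

lemma kostka_sum: "sorted_wrt (\<ge>) p \<Longrightarrow> kostka p as \<noteq> 0 \<Longrightarrow> sum_list p = sum_list as"
  using tableau.peel_count_sum[OF is_shape_rows] by (simp add: kostka_def card_diagram_rows)

text \<open>Since \<open>p (Suc i) \<le> q i\<close>, removing one strip lowers the number of rows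
  by at most one.\<close>

lemma peel_count_tableau_rows:
  "antimono p \<Longrightarrow> finite (diagram p) \<Longrightarrow> peel_count tableau_layer (diagram p) as \<noteq> 0 \<Longrightarrow> p (length as) = 0"
proof (induction as arbitrary: p)
  case Nil
  then have "diagram p = {}" by (simp split: if_splits)
  then show ?case by (metis empty_iff mem_diagram not_gr_zero)
next
  case (Cons a as)
  then obtain T where T: "T \<in> layers tableau_layer (diagram p) a" "peel_count tableau_layer T as \<noteq> 0"
    by (metis peel_count.simps(2) sum.not_neutral_contains_not_neutral)
  then obtain q where q: "T = diagram q" "interlaces p q"
    unfolding tableau_layers[OF Cons.prems(2)] by blast
  then have "finite (diagram q)" using tableau_layer_iff Cons.prems(2) by (meson finite_subset)
  then have "q (length as) = 0" using Cons.IH[of q] interlaces_antimono q T by blast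
  then show ?case using q(2) by (metis interlaces_def le_zero_eq length_Cons)
qed

lemma kostka_length:
  assumes "is_partition p" "kostka p as \<noteq> 0" shows "length p \<le> length as"
proof (rule ccontr)
  assume l: "\<not> length p \<le> length as"
  have "rows p (length as) = 0"
    using assms peel_count_tableau_rows[OF antimono_rows finite_diagram_rows]
    by (auto simp: kostka_def is_partition_def)
  moreover have "p ! length as \<in> set p" using l by simp
  ultimately show False using l assms(1) by (auto simp: rows_def is_partition_def)
qed

section \<open>Existence and uniqueness of Schur expansions\<close>

section \<open>Schur expansions\<close>

definition parts :: "nat list \<Rightarrow> nat list" where
  "parts as = rev (sort (filter (\<lambda>a. a \<noteq> 0) as))"

lemma is_partition_parts: "is_partition (parts as)"
  by (auto simp: is_partition_def parts_def sorted_wrt_rev)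

lemma mset_parts: "mset (parts as) = mset (filter (\<lambda>a. a \<noteq> 0) as)"
  by (simp add: parts_def)

lemma sum_list_parts: "sum_list (parts as) = sum_list as"
proof -
  have "sum_list (parts as) = sum_list (filter (\<lambda>a. a \<noteq> 0) as)"
    using mset_parts by (metis sum_mset_sum_list)
  also have "\<dots> = sum_list as" by (induction as) auto
  finally show ?thesis .
qed

lemma (in peeling) peel_count_parts: "Inv S \<Longrightarrow> peel_count ok S (parts as) = peel_count ok S as"
  using peel_count_perm[OF _ mset_parts] peel_count_drop_zeros by metis

lemma kostka_parts: "is_partition p \<Longrightarrow> kostka p (parts as) = kostka p as"
  using tableau.peel_count_parts[OF is_shape_rows] by (simp add: kostka_def is_partition_def)

lemma finite_partitions: "finite {p. is_partition p \<and> sum_list p = n}"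
proof (rule finite_subset)
  show "{p. is_partition p \<and> sum_list p = n} \<subseteq> {p. set p \<subseteq> {..n} \<and> length p \<le> n}"
  proof clarify
    fix p assume p: "is_partition p" "n = sum_list p"
    have "length p \<le> sum_list p" if "0 \<notin> set p" for p :: "nat list"
      using that by (induction p) auto
    then show "set p \<subseteq> {..sum_list p} \<and> length p \<le> sum_list p"
      using p member_le_sum_list by (auto simp: is_partition_def)
  qed
  show "finite {p. set p \<subseteq> {..n} \<and> length p \<le> n}" by (rule finite_lists_length_le) simp
qed

text \<open>Unknowns are determined from the largest index down. A new minimum \<open>b\<close>
  disturbs no equation at a larger \<open>m\<close>, because \<open>K b m = 0\<close> there, and
  \<open>K b b = 1\<close> lets the equation at \<open>b\<close> be solved over the
  integers.\<close>

lemma unitriangular_solve: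
  fixes K :: "'a::linorder \<Rightarrow> 'a \<Rightarrow> int"
  assumes "finite P" "\<And>p. p \<in> P \<Longrightarrow> K p p = 1"
    and "\<And>p m. p \<in> P \<Longrightarrow> m \<in> P \<Longrightarrow> K p m \<noteq> 0 \<Longrightarrow> m \<le> p"
  shows "\<exists>c. \<forall>m\<in>P. (\<Sum>p\<in>P. c p * K p m) = F m"
  using assms
proof (induction P rule: finite_linorder_min_induct)
  case (insert b A)
  then obtain c where c: "\<forall>m\<in>A. (\<Sum>p\<in>A. c p * K p m) = F m" by auto
  define c' where "c' = c(b := F b - (\<Sum>p\<in>A. c p * K p b))"
  have b: "b \<notin> A" using insert.hyps by blast
  have eq: "(\<Sum>p\<in>A. c' p * K p m) = (\<Sum>p\<in>A. c p * K p m)" for m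
    by (rule sum.cong) (use b in \<open>auto simp: c'_def\<close>)
  have "K b m = 0" if "m \<in> A" for m
    using insert.prems(2)[of b m] insert.hyps(2) that by force
  then have "(\<Sum>p\<in>insert b A. c' p * K p m) = F m" if "m \<in> insert b A" for m
    using that insert.hyps(1) b c insert.prems(1) by (auto simp: eq) (simp add: c'_def)
  then show ?case by blast
qed simp

text \<open>Triangularity yields integer coefficients from the values at partitions of
  \<open>n\<close>. Symmetry carries the identity to all contents of sum \<open>n\<close>,
  homogeneity covers the other degrees, and both sides vanish on monomials containing 0.\<close>

theorem schur_expansion_exists:
  assumes zero: "\<And>M. 0 \<in># M \<Longrightarrow> f M = 0"
    and sym: "\<And>as. f (content_mset (parts as)) = f (content_mset as)"
    and hom: "\<And>as. sum_list as \<noteq> n \<Longrightarrow> f (content_mset as) = 0"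
  shows "\<exists>c. is_schur_expansion f c"
proof -
  let ?P = "{p. is_partition p \<and> sum_list p = n}"
  obtain c where c: "\<forall>m\<in>?P. (\<Sum>p\<in>?P. c p * int (kostka p m)) = f (content_mset m)"
    using unitriangular_solve[OF finite_partitions[of n], of "\<lambda>p m. int (kostka p m)" "\<lambda>m. f (content_mset m)"]
      kostka_self kostka_triangular by (auto simp: is_partition_def)
  \<comment> \<open>Nothing is known of \<open>c\<close> outside \<open>?P\<close>; cutting it off
    there gives a finite support of partitions.\<close>
  define d where "d p = (if p \<in> ?P then c p else 0)" for p
  have supp: "{p. d p \<noteq> 0} \<subseteq> ?P" by (auto simp: d_def)
  have "f M = (\<Sum>p | d p \<noteq> 0. d p * schur_function p M)" for M
  proof (cases "0 \<in># M")
    case True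
    have "schur_function p M = 0" for p
    proof -
      have "M \<noteq> image_mset T (mset_set (young_diagram p))" if "T \<in> semistandard_tableaux p" for T
      proof
        assume "M = image_mset T (mset_set (young_diagram p))"
        with True obtain z where z: "z \<in> young_diagram p" "T z = 0"
          by (auto simp: young_diagram_rows finite_diagram_rows)
        have "T \<in> young_diagram p \<rightarrow>\<^sub>E {1..}" using that by (simp add: semistandard_tableaux_def)
        then have "T z \<in> {1..}" using z(1) by (rule PiE_mem)
        then show False using z(2) by simp
      qed
      then have "{T \<in> semistandard_tableaux p. image_mset T (mset_set (young_diagram p)) = M} = {}"
        by blast
      then show ?thesis by (simp only: schur_function_def card.empty)
    qed
    then show ?thesis using zero[OF True] by simp
  next
    case False
    then obtain as where M: "M = content_mset as" by (rule content_mset_surj)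
    have "(\<Sum>p | d p \<noteq> 0. d p * schur_function p M) = (\<Sum>p\<in>?P. d p * schur_function p M)"
      by (rule sum.mono_neutral_left[OF finite_partitions supp]) auto
    also have "\<dots> = (\<Sum>p\<in>?P. c p * int (kostka p (parts as)))"
      by (rule sum.cong) (auto simp: d_def M schur_content kostka_parts)
    also have "\<dots> = f M"
    proof (cases "sum_list as = n")
      case True
      then have "parts as \<in> ?P" by (simp add: is_partition_parts sum_list_parts)
      then show ?thesis using c sym M by auto
    next
      case False
      then have "kostka p (parts as) = 0" if "p \<in> ?P" for p
        using that kostka_sum[of p "parts as"] by (auto simp: is_partition_def sum_list_parts)
      then show ?thesis using hom[OF False] M by simp
    qed
    finally show ?thesis by simp
  qed
  then have "is_schur_expansion f d"
    unfolding is_schur_expansion_def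
    using supp finite_subset[OF supp finite_partitions] by auto
  then show ?thesis by blast
qed

text \<open>At the largest \<open>m\<close> in \<open>U\<close> with nonzero coefficient, any other
  contributing shape would lie in \<open>U\<close> and above \<open>m\<close>, so the equation at
  \<open>m\<close> reads \<open>c m = 0\<close>. For uniqueness \<open>U\<close> consists of all
  partitions, for the graph of those with first part at least 5.\<close>

lemma schur_coefficients_vanish:
  assumes A: "finite A" "\<And>p. p \<in> A \<Longrightarrow> is_partition p"
    and U: "\<And>m p. m \<in> U \<Longrightarrow> is_partition m \<and> (is_partition p \<longrightarrow> kostka p m \<noteq> 0 \<longrightarrow> p \<in> U)"
    and eq: "\<And>m. m \<in> U \<Longrightarrow> (\<Sum>p\<in>A. c p * int (kostka p m)) = (0::int)"
    and p: "p \<in> A" "p \<in> U"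
  shows "c p = 0"
proof (rule ccontr)
  assume "c p \<noteq> 0"
  let ?B = "{p \<in> A. p \<in> U \<and> c p \<noteq> 0}"
  have B: "finite ?B" "?B \<noteq> {}" using A(1) p \<open>c p \<noteq> 0\<close> by auto
  define m where "m = Max ?B"
  have m: "m \<in> A" "m \<in> U" "c m \<noteq> 0" using Max_in[OF B] by (auto simp: m_def)
  have "c q * int (kostka q m) = 0" if q: "q \<in> A - {m}" for q
  proof (rule ccontr)
    assume n: "c q * int (kostka q m) \<noteq> 0"
    then have "q \<in> ?B" using q A(2) U[OF m(2), of q] by auto
    then have "q \<le> m" using Max_ge[OF B(1)] by (simp add: m_def)
    moreover have "m \<le> q"
      using n q A(2)[of q] U[OF m(2), of m] kostka_triangular[of q m] by (auto simp: is_partition_def)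
    ultimately show False using q by simp
  qed
  then have "(\<Sum>p\<in>A. c p * int (kostka p m)) = c m * int (kostka m m)"
    using A(1) m(1) by (simp add: sum.remove[of A m] sum.neutral)
  also have "\<dots> = c m" using kostka_self A(2)[OF m(1)] by (simp add: is_partition_def)
  finally show False using eq m by simp
qed

lemma schur_expansion_content:
  assumes "is_schur_expansion f c"
  shows "f (content_mset as) = (\<Sum>p | c p \<noteq> 0. c p * int (kostka p as))"
proof -
  have "f (content_mset as) = (\<Sum>p | c p \<noteq> 0. c p * schur_function p (content_mset as))"
    using assms by (auto simp: is_schur_expansion_def)
  also have "\<dots> = (\<Sum>p | c p \<noteq> 0. c p * int (kostka p as))"
    by (rule sum.cong) (use assms in \<open>auto simp: is_schur_expansion_def schur_content\<close>)
  finally show ?thesis .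
qed

theorem schur_expansion_unique:
  assumes c: "is_schur_expansion f c" and d: "is_schur_expansion f d"
  shows "c = d"
proof
  fix p
  let ?A = "{p. c p \<noteq> 0} \<union> {p. d p \<noteq> 0}"
  have A: "finite ?A" "\<And>p. p \<in> ?A \<Longrightarrow> is_partition p"
    using c d by (auto simp: is_schur_expansion_def)
  have "(\<Sum>p\<in>?A. (c p - d p) * int (kostka p m)) = 0" for m
  proof -
    have "(\<Sum>p\<in>?A. c p * int (kostka p m)) = f (content_mset m)"
      unfolding schur_expansion_content[OF c] by (rule sum.mono_neutral_right[OF A(1)]) auto
    moreover have "(\<Sum>p\<in>?A. d p * int (kostka p m)) = f (content_mset m)"
      unfolding schur_expansion_content[OF d] by (rule sum.mono_neutral_right[OF A(1)]) auto
    ultimately show ?thesis by (simp add: left_diff_distrib sum_subtractf)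
  qed
  then show "c p = d p"
    using schur_coefficients_vanish[OF A, of "{p. is_partition p}" "\<lambda>p. c p - d p" p] A(2)
    by (cases "p \<in> ?A") auto
qed

lemma schur_coeff_eq: "is_schur_expansion f c \<Longrightarrow> schur_coeff f p = c p"
  using schur_expansion_unique by (metis schur_coeff_def the_equality)

section \<open>Executable Kostka and colouring numbers\<close>

section \<open>Evaluation\<close>

text \<open>Each row of the smaller shape varies between the next row of \<open>p\<close> and the
  row itself, independently of the others, hence the product. Emptied rows stay as zeros, so all
  lists have the length of \<open>p\<close>.\<close>

primrec strips :: "nat list \<Rightarrow> nat list list" where
  "strips [] = [[]]"
| "strips (x # p) = map (\<lambda>(y, q). y # q)
     (List.product [(case p of [] \<Rightarrow> 0 | z # _ \<Rightarrow> z)..<Suc x] (strips p))"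

primrec kostka_eval :: "nat list \<Rightarrow> nat list \<Rightarrow> nat" where
  "kostka_eval p [] = (if list_all (\<lambda>x. x = 0) p then 1 else 0)"
| "kostka_eval p (a # as) =
     (\<Sum>q\<leftarrow>filter (\<lambda>q. sum_list q + a = sum_list p) (strips p). kostka_eval q as)"

lemma interlaces_rows_Cons:
  "interlaces (rows (x # p)) (rows (y # q)) \<longleftrightarrow> rows p 0 \<le> y \<and> y \<le> x \<and> interlaces (rows p) (rows q)"
proof -
  have "(\<forall>i. P i) \<longleftrightarrow> P 0 \<and> (\<forall>i. P (Suc i))" for P :: "nat \<Rightarrow> bool"
    by (metis not0_implies_Suc)
  from this[of "\<lambda>i. rows (x # p) (Suc i) \<le> rows (y # q) i \<and> rows (y # q) i \<le> rows (x # p) i"]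
  show ?thesis by (simp add: interlaces_def)
qed

lemma set_strips: "q \<in> set (strips p) \<longleftrightarrow> length q = length p \<and> interlaces (rows p) (rows q)"
proof (induction p arbitrary: q)
  case Nil
  then show ?case by (auto simp: interlaces_def)
next
  case (Cons x p)
  have "(case p of [] \<Rightarrow> 0 | z # _ \<Rightarrow> z) = rows p 0" by (cases p) auto
  then show ?case
    using Cons.IH by (cases q) (auto simp: interlaces_rows_Cons image_iff)
qed

lemma distinct_strips: "distinct (strips p)"
  by (induction p) (auto simp: distinct_map inj_on_def intro!: distinct_product simp del: upt_Suc)

lemma rows_inject: "length p = length q \<Longrightarrow> rows p = rows q \<Longrightarrow> p = q"
  by (intro nth_equalityI) (auto simp: rows_def fun_eq_iff split: if_splits)

lemma strips_interlacing: "{q. interlaces (rows p) q} = rows ` set (strips p)"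
proof -
  have "\<exists>q'. length q' = length p \<and> q = rows q'" if q: "interlaces (rows p) q" for q
  proof (intro exI conjI)
    have "q i = 0" if "length p \<le> i" for i
      using q that by (metis interlaces_def le_zero_eq leD rows_def)
    then show "q = rows (map q [0..<length p])" by (auto simp: rows_def fun_eq_iff)
  qed simp
  then show ?thesis by (fastforce simp: set_strips)
qed

text \<open>Lists of equal length, zeros included, give different diagrams when they differ, so the
  sum over layers becomes a sum over the distinct list \<open>strips p\<close>.\<close>

lemma kostka_eval: "kostka p as = kostka_eval p as"
proof (induction as arbitrary: p)
  case Nil
  have "diagram (rows p) = {} \<longleftrightarrow> (\<forall>x\<in>set p. x = 0)"
  proof -
    have "diagram (rows p) = {} \<longleftrightarrow> card (diagram (rows p)) = 0"
      using finite_diagram_rows by simp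
    then show ?thesis by (simp add: card_diagram_rows)
  qed
  then show ?case by (simp add: kostka_def list_all_iff)
next
  case (Cons a as)
  let ?L = "filter (\<lambda>q. sum_list q + a = sum_list p) (strips p)"
  have "layers tableau_layer (diagram (rows p)) a
      = diagram ` {q \<in> rows ` set (strips p). card (diagram q) + a = sum_list p}"
    unfolding tableau_layers[OF finite_diagram_rows] card_diagram_rows
    by (simp add: Collect_conj_eq flip: strips_interlacing)
  also have "\<dots> = (\<lambda>q. diagram (rows q)) ` set ?L"
    by (auto simp: card_diagram_rows)
  finally have "kostka p (a # as) = (\<Sum>T\<in>(\<lambda>q. diagram (rows q)) ` set ?L. peel_count tableau_layer T as)"
    by (simp add: kostka_def)
  also have "\<dots> = (\<Sum>q\<in>set ?L. kostka q as)"
  proof (subst sum.reindex)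
    show "inj_on (\<lambda>q. diagram (rows q)) (set ?L)"
      by (auto simp: inj_on_def diagram_inject set_strips intro: rows_inject)
  qed (simp add: kostka_def)
  also have "\<dots> = kostka_eval p (a # as)"
    using distinct_strips by (simp add: Cons.IH sum_list_distinct_conv_sum_set)
  finally show ?case .
qed

text \<open>Returns what is left of \<open>vs\<close> after removing a stable set; \<open>us\<close> is the part of that set chosen
  so far.\<close>

fun stable_rests :: "('a \<Rightarrow> 'a \<Rightarrow> bool) \<Rightarrow> 'a list \<Rightarrow> nat \<Rightarrow> 'a list \<Rightarrow> 'a list list" where
  "stable_rests adj us 0 vs = [vs]"
| "stable_rests adj us (Suc a) [] = []"
| "stable_rests adj us (Suc a) (v # vs) =
     (if list_all (\<lambda>u. \<not> adj v u) us then stable_rests adj (v # us) a vs else [])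
     @ map ((#) v) (stable_rests adj us (Suc a) vs)"

primrec colouring_eval :: "('a \<Rightarrow> 'a \<Rightarrow> bool) \<Rightarrow> 'a list \<Rightarrow> nat list \<Rightarrow> int" where
  "colouring_eval adj vs [] = (case vs of [] \<Rightarrow> 1 | _ \<Rightarrow> 0)"
| "colouring_eval adj vs (a # as) = (\<Sum>r\<leftarrow>stable_rests adj [] a vs. colouring_eval adj r as)"

text \<open>\<open>U\<close> holds the vertices chosen earlier and mirrors the accumulator of
  \<open>stable_rests\<close>.\<close>

definition stable_sets :: "('a \<Rightarrow> 'a \<Rightarrow> bool) \<Rightarrow> 'a set \<Rightarrow> nat \<Rightarrow> 'a set \<Rightarrow> 'a set set" where
  "stable_sets adj U a V = {A. A \<subseteq> V \<and> card A = a \<and> (\<forall>v\<in>A. \<forall>w\<in>A \<union> U. \<not> adj v w)}"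

lemma stable_sets_insert:
  assumes adj: "symp adj" "irreflp adj" and V: "v \<notin> V" "finite V"
  shows "stable_sets adj U (Suc a) (insert v V) =
    (if \<forall>u\<in>U. \<not> adj v u then insert v ` stable_sets adj (insert v U) a V else {})
    \<union> stable_sets adj U (Suc a) V" (is "?L = ?I \<union> ?R")
proof (intro equalityI subsetI)
  fix B assume B: "B \<in> ?L"
  show "B \<in> ?I \<union> ?R"
  proof (cases "v \<in> B")
    case True
    let ?A = "B - {v}"
    have "finite B" using B V(2) by (auto simp: stable_sets_def intro: finite_subset)
    then have A: "?A \<in> stable_sets adj (insert v U) a V" and ok: "\<forall>u\<in>U. \<not> adj v u"
      using B True by (auto simp: stable_sets_def)
    have "B = insert v ?A" using True by blast
    then have "B \<in> insert v ` stable_sets adj (insert v U) a V" using A by (rule image_eqI)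
    then show ?thesis using ok by simp
  qed (use B in \<open>auto simp: stable_sets_def\<close>)
next
  fix B assume "B \<in> ?I \<union> ?R"
  then show "B \<in> ?L"
  proof
    assume "B \<in> ?I"
    then obtain A where A: "A \<in> stable_sets adj (insert v U) a V" "B = insert v A" "\<forall>u\<in>U. \<not> adj v u"
      by (auto split: if_splits)
    moreover have "finite A" "v \<notin> A" using A(1) V by (auto simp: stable_sets_def intro: finite_subset)
    moreover have "\<not> adj v v" "\<And>w. adj v w \<Longrightarrow> adj w v" using adj by (auto dest: sympD irreflpD)
    ultimately show ?thesis by (auto simp: stable_sets_def)
  qed (auto simp: stable_sets_def)
qed

text \<open>An arbitrary weight \<open>h\<close> lets the induction absorb a skipped vertex by
  passing to \<open>\<lambda>r. h (v # r)\<close>. Weight 1 counts stable sets; the colouring number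
  of the rest as weight gives one step of the colouring recursion.\<close>

lemma sum_stable_rests:
  fixes h :: "'a list \<Rightarrow> int"
  assumes "symp adj" "irreflp adj" "distinct vs"
  shows "(\<Sum>r\<leftarrow>stable_rests adj us a vs. h r)
    = (\<Sum>A\<in>stable_sets adj (set us) a (set vs). h (filter (\<lambda>v. v \<notin> A) vs))"
  using assms
proof (induction adj us a vs arbitrary: h rule: stable_rests.induct)
  case (1 adj us vs)
  have "stable_sets adj (set us) 0 (set vs) = {{}}"
    by (auto simp: stable_sets_def dest: finite_subset[OF _ finite_set])
  then show ?case by simp
next
  case (2 adj us a)
  have "stable_sets adj (set us) (Suc a) (set []) = {}" by (auto simp: stable_sets_def)
  then show ?case by simp
next
  case (3 adj us a v vs)
  then have v: "v \<notin> set vs" and d: "distinct vs" by auto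
  let ?ok = "\<forall>u\<in>set us. \<not> adj v u"
  let ?I = "stable_sets adj (insert v (set us)) a (set vs)" and ?R = "stable_sets adj (set us) (Suc a) (set vs)"
  let ?f = "\<lambda>A. filter (\<lambda>w. w \<notin> A) (v # vs)"
  have sub: "A \<subseteq> set vs" if "A \<in> ?I \<or> A \<in> ?R" for A using that by (auto simp: stable_sets_def)
  have fin: "finite ?I" "finite ?R"
    by (rule finite_subset[of _ "Pow (set vs)"]; auto simp: stable_sets_def)+
  have rest: "?f (insert v A) = filter (\<lambda>w. w \<notin> A) vs" if "A \<in> ?I" for A
    using v by (auto intro: filter_cong)
  have inj: "inj_on (insert v) ?I"
    using sub v by (intro inj_onI) (metis insert_ident subsetD)
  have "(\<Sum>A\<in>stable_sets adj (set us) (Suc a) (set (v # vs)). h (?f A))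
      = (\<Sum>A\<in>(if ?ok then insert v ` ?I else {}). h (?f A)) + (\<Sum>A\<in>?R. h (?f A))"
    unfolding list.set(2) stable_sets_insert[OF 3(3,4) v finite_set]
    by (rule sum.union_disjoint) (use fin sub v in \<open>auto split: if_splits\<close>)
  also have "(\<Sum>A\<in>(if ?ok then insert v ` ?I else {}). h (?f A))
      = (if ?ok then \<Sum>A\<in>?I. h (filter (\<lambda>w. w \<notin> A) vs) else 0)"
    using rest by (auto simp: sum.reindex[OF inj] simp del: filter.simps intro!: sum.cong)
  also have "(\<Sum>A\<in>?R. h (?f A)) = (\<Sum>A\<in>?R. h (v # filter (\<lambda>w. w \<notin> A) vs))"
    using sub v by (intro sum.cong) auto
  finally show ?case
    using 3(1)[OF _ 3(3,4) d] 3(2)[OF 3(3,4) d, of "\<lambda>r. h (v # r)"]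
    by (simp add: list_all_iff o_def)
qed

text \<open>Layers are named by the set that remains, the enumeration by the stable set removed;
  taking complements in \<open>set vs\<close> translates between the two.\<close>

lemma colouring_eval:
  assumes adj: "symp adj" "irreflp adj"
    and E: "\<And>v w. {v, w} \<in> E \<longleftrightarrow> adj v w"
  shows "distinct vs \<Longrightarrow> int (peel_count (colour_layer E) (set vs) as) = colouring_eval adj vs as"
proof (induction as arbitrary: vs)
  case Nil
  then show ?case by (simp split: list.split)
next
  case (Cons a as)
  let ?S = "stable_sets adj {} a (set vs)"
  have layers: "layers (colour_layer E) (set vs) a = (\<lambda>A. set vs - A) ` ?S"
  proof (intro equalityI subsetI)
    fix T assume T: "T \<in> layers (colour_layer E) (set vs) a"
    then have "set vs - T \<in> ?S" by (auto simp: layers_def stable_sets_def colour_layer_def E)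
    moreover have "T = set vs - (set vs - T)" using T by (auto simp: layers_def)
    ultimately show "T \<in> (\<lambda>A. set vs - A) ` ?S" by blast
  next
    fix T assume "T \<in> (\<lambda>A. set vs - A) ` ?S"
    then obtain A where A: "A \<in> ?S" "T = set vs - A" by blast
    then have "set vs - T = A" by (auto simp: stable_sets_def)
    then show "T \<in> layers (colour_layer E) (set vs) a"
      using A by (auto simp: layers_def stable_sets_def colour_layer_def E)
  qed
  have inj: "inj_on (\<lambda>A. set vs - A) ?S"
    by (intro inj_onI) (auto simp: stable_sets_def)
  have "int (peel_count (colour_layer E) (set vs) (a # as))
      = (\<Sum>A\<in>?S. int (peel_count (colour_layer E) (set vs - A) as))"
    by (simp add: layers sum.reindex[OF inj])
  also have "\<dots> = (\<Sum>A\<in>?S. colouring_eval adj (filter (\<lambda>v. v \<notin> A) vs) as)"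
  proof (rule sum.cong[OF refl])
    fix A
    have "set vs - A = set (filter (\<lambda>v. v \<notin> A) vs)" by auto
    then show "int (peel_count (colour_layer E) (set vs - A) as) = colouring_eval adj (filter (\<lambda>v. v \<notin> A) vs) as"
      using Cons.IH[of "filter (\<lambda>v. v \<notin> A) vs"] Cons.prems by simp
  qed
  also have "\<dots> = colouring_eval adj vs (a # as)"
    using sum_stable_rests[OF adj Cons.prems, of "\<lambda>r. colouring_eval adj r as" "[]" a] by simp
  finally show ?case .
qed

text \<open>Subsets of stable sets are stable, so a layer of size at least \<open>k\<close> would
  contain a stable set of size \<open>k\<close>; summing weight 1 over the empty list of rests
  excludes this.\<close>

lemma no_large_stable_set:
  assumes adj: "symp adj" "irreflp adj" and E: "\<And>v w. {v, w} \<in> E \<longleftrightarrow> adj v w"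
    and "distinct vs" "stable_rests adj [] k vs = []" "k \<le> a"
  shows "peel_count (colour_layer E) (set vs) (a # as) = 0"
proof -
  have "(\<Sum>A\<in>stable_sets adj {} k (set vs). 1 :: int) = 0"
    using sum_stable_rests[OF adj assms(4), of "\<lambda>_. 1" "[]" k] assms(5) by simp
  moreover have "finite (stable_sets adj {} k (set vs))"
    by (rule finite_subset[of _ "Pow (set vs)"]) (auto simp: stable_sets_def)
  ultimately have none: "stable_sets adj {} k (set vs) = {}" by simp
  have "layers (colour_layer E) (set vs) a = {}"
  proof (rule ccontr)
    assume "layers (colour_layer E) (set vs) a \<noteq> {}"
    then obtain T where T: "T \<subseteq> set vs" "colour_layer E (set vs) T" "card (set vs - T) = a"
      by (auto simp: layers_def)
    then obtain A where "A \<subseteq> set vs - T" "card A = k"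
      using assms(6) by (metis obtain_subset_with_card_n)
    then have "A \<in> stable_sets adj {} k (set vs)"
      using T(2) by (auto simp: stable_sets_def colour_layer_def E)
    then show False using none by blast
  qed
  then show ?thesis by simp
qed

text \<open>An injective relabelling preserves stable sets. It allows counting on the numbers 0 to
  11 instead of the edges of \<open>graph_H\<close>.\<close>

lemma peel_count_image:
  assumes g: "inj_on g V" and E: "E \<subseteq> Pow V"
  shows "S \<subseteq> V \<Longrightarrow> peel_count (colour_layer ((`) g ` E)) (g ` S) as = peel_count (colour_layer E) S as"
proof (induction as arbitrary: S)
  case Nil
  then show ?case by simp
next
  case (Cons a as)
  have edge: "{g v, g w} \<in> (`) g ` E \<longleftrightarrow> {v, w} \<in> E" if "v \<in> V" "w \<in> V" for v w
  proof -
    have "{g v, g w} = g ` {v, w}" by simp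
    moreover have "inj_on ((`) g) (Pow V)" using g by (rule inj_on_image_Pow)
    ultimately show ?thesis using that E by (metis empty_subsetI inj_on_image_mem_iff insert_subset Pow_iff)
  qed
  have diff: "g ` S - g ` T = g ` (S - T)" if "T \<subseteq> S" for T
    using g Cons.prems that by (metis inj_on_image_set_diff inj_on_subset Diff_subset subset_trans)
  have same: "g ` T \<in> layers (colour_layer ((`) g ` E)) (g ` S) a \<longleftrightarrow> T \<in> layers (colour_layer E) S a"
    if "T \<subseteq> S" for T
  proof -
    have "card (g ` (S - T)) = card (S - T)"
      using g Cons.prems by (intro card_image inj_on_subset[OF g]) auto
    moreover have "colour_layer ((`) g ` E) (g ` S) (g ` T) \<longleftrightarrow> colour_layer E S T"
      unfolding colour_layer_def diff[OF that] using edge Cons.prems by (simp add: subset_iff)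
    ultimately show ?thesis using that diff[OF that] by (auto simp: layers_def)
  qed
  have layers: "layers (colour_layer ((`) g ` E)) (g ` S) a = (`) g ` layers (colour_layer E) S a"
  proof (intro equalityI subsetI)
    fix T' assume T': "T' \<in> layers (colour_layer ((`) g ` E)) (g ` S) a"
    then obtain T where "T \<subseteq> S" "T' = g ` T" by (auto simp: layers_def subset_image_iff)
    then show "T' \<in> (`) g ` layers (colour_layer E) S a" using same T' by blast
  next
    fix T' assume "T' \<in> (`) g ` layers (colour_layer E) S a"
    then obtain T where T: "T \<in> layers (colour_layer E) S a" "T' = g ` T" by blast
    then have "T \<subseteq> S" by (simp add: layers_def)
    then show "T' \<in> layers (colour_layer ((`) g ` E)) (g ` S) a" using same T by blast
  qed
  have "layers (colour_layer E) S a \<subseteq> Pow V" using Cons.prems by (auto simp: layers_def)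
  then have "inj_on ((`) g) (layers (colour_layer E) S a)"
    using g inj_on_image_Pow inj_on_subset by blast
  then show ?case
    using Cons by (simp add: layers sum.reindex) (auto simp: layers_def intro!: sum.cong)
qed

lemma chromatic_schur_expansion:
  assumes fin: "finite (verts G)"
  shows "\<exists>c. is_schur_expansion (chromatic_symmetric_function G) c"
proof (rule schur_expansion_exists[where n = "card (verts G)"])
  fix M :: "nat multiset" assume M: "0 \<in># M"
  have "M \<noteq> image_mset \<kappa> (mset_set (verts G))" if k: "\<kappa> \<in> proper_colourings G" for \<kappa>
  proof
    assume "M = image_mset \<kappa> (mset_set (verts G))"
    with M fin obtain v where v: "v \<in> verts G" "\<kappa> v = 0" by auto
    have "\<kappa> \<in> verts G \<rightarrow>\<^sub>E {1..}" using k by (simp add: proper_colourings_def)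
    then have "\<kappa> v \<in> {1..}" using v(1) by (rule PiE_mem)
    then show False using v(2) by simp
  qed
  then have "{\<kappa> \<in> proper_colourings G. image_mset \<kappa> (mset_set (verts G)) = M} = {}" by blast
  then show "chromatic_symmetric_function G M = 0"
    by (simp only: chromatic_symmetric_function_def card.empty)
next
  fix as :: "nat list"
  show "chromatic_symmetric_function G (content_mset (parts as)) = chromatic_symmetric_function G (content_mset as)"
    by (simp add: chromatic_content[OF fin] colouring.peel_count_parts[OF fin])
  show "chromatic_symmetric_function G (content_mset as) = 0" if "sum_list as \<noteq> card (verts G)"
    using that colouring.peel_count_sum[OF fin, of "edges G" as] by (auto simp: chromatic_content[OF fin])
qed

text \<open>The leaves of a claw would be three pairwise disjoint edges, all meeting the central
  edge, which would then have three different endpoints.\<close>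

lemma claw_free_line_graph:
  assumes H: "simple_graph H" shows "claw_free (line_graph H)"
  unfolding claw_free_def
proof
  let ?G = "line_graph H"
  assume "\<exists>W\<subseteq>verts ?G. graph_iso (induced_subgraph ?G W) claw"
  then obtain W f where W: "W \<subseteq> edges H" and f: "bij_betw f W {0, 1, 2, 3 :: nat}"
    and edges: "(\<lambda>e. f ` e) ` {e \<in> edges ?G. e \<subseteq> W} = {{0, 1}, {0, 2}, {0, 3}}"
    by (auto simp: graph_iso_def induced_subgraph_def claw_def line_graph_def)
  \<comment> \<open>\<open>e i\<close> is the edge of \<open>H\<close> in the place of claw vertex
    \<open>i\<close>; \<open>e 0\<close> is the centre.\<close>
  define e where "e = inv_into W f"
  have e: "e i \<in> W" "f (e i) = i" if "i \<in> {0, 1, 2, 3}" for i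
    using that f by (auto simp: e_def bij_betw_def inv_into_into f_inv_into_f)
  have inj: "inj_on f W" using f by (simp add: bij_betw_def)
  have meet: "e 0 \<inter> e i \<noteq> {}" if i: "i \<in> {1, 2, 3}" for i
  proof -
    have "{0, i} \<in> (\<lambda>e. f ` e) ` {e \<in> edges ?G. e \<subseteq> W}" unfolding edges using i by auto
    then obtain x where x: "x \<in> edges ?G" "x \<subseteq> W" "f ` x = {0, i}" by auto
    have "f ` {e 0, e i} = {0, i}" using e(2)[of 0] e(2)[of i] i by auto
    then have "x = {e 0, e i}"
      using x inj_on_image_eq_iff[OF inj, of x "{e 0, e i}"] e(1)[of 0] e(1)[of i] i by auto
    then show ?thesis using x(1) by (auto simp: line_graph_def doubleton_eq_iff)
  qed
  have disj: "e i \<inter> e j = {}" if i: "i \<in> {1, 2, 3}" and j: "j \<in> {1, 2, 3}" and "i \<noteq> j" for i j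
  proof (rule ccontr)
    assume "e i \<inter> e j \<noteq> {}"
    moreover have "e i \<noteq> e j" using e(2)[of i] e(2)[of j] that by auto
    ultimately have "{e i, e j} \<in> {e \<in> edges ?G. e \<subseteq> W}"
      using e(1)[of i] e(1)[of j] i j W by (auto simp: line_graph_def)
    then have "f ` {e i, e j} \<in> {{0, 1}, {0, 2}, {0, 3}}" unfolding edges[symmetric] by blast
    moreover have "f ` {e i, e j} = {i, j}" using e(2)[of i] e(2)[of j] i j by auto
    ultimately show False using i j \<open>i \<noteq> j\<close> by (auto simp: doubleton_eq_iff)
  qed
  obtain x y z where xyz: "x \<in> e 0" "y \<in> e 0" "z \<in> e 0" "x \<in> e 1" "y \<in> e 2" "z \<in> e 3"
    using meet[of 1] meet[of 2] meet[of 3] by auto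
  then have "x \<noteq> y" "x \<noteq> z" "y \<noteq> z"
    using disj[of 1 2] disj[of 1 3] disj[of 2 3] by auto
  then have "card {x, y, z} = 3" by simp
  moreover have "card (e 0) = 2" using H W e(1)[of 0] by (auto simp: simple_graph_def)
  moreover have "{x, y, z} \<subseteq> e 0" using xyz by simp
  ultimately show False using card_mono[of "e 0" "{x, y, z}"] by (simp add: card_ge_0_finite)
qed

section \<open>The line graph with vertices numbered 0 to 11\<close>

section \<open>The graph\<close>

text \<open>This numbering is the isomorphism from the graph6 graph to the line graph.\<close>

definition H_edge :: "nat \<Rightarrow> vtx set" where
  "H_edge i = [{Va, Vu}, {Vb, Vc}, {Vx, Vy}, {Vd, Vm}, {Va, Vv}, {Vb, Vl},
     {Vu, Vv}, {Vc, Vx}, {Vd, Va}, {Vc, Vy}, {Va, Vb}, {Vc, Vd}] ! i"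

text \<open>The case distinction on \<open>drop\<close> makes \<open>nbrs i\<close> empty for
  \<open>i > 11\<close>, so \<open>graph6_edge_iff\<close> can hold for all natural numbers.\<close>

definition nbrs :: "nat \<Rightarrow> nat list" where
  "nbrs i = (case drop i [[4,6,8,10], [5,7,9,10,11], [7,9], [8,11], [0,6,8,10], [1,10], [0,4],
     [1,2,9,11], [0,3,4,10,11], [1,2,7,11], [0,1,4,5,8], [1,3,7,8,9]] of [] \<Rightarrow> [] | ns # _ \<Rightarrow> ns)"

lemma atLeastAtMost_0_11: "{0..11} = set [0..<12 :: nat]"
  by (simp add: atLeastAtMost_upt)

text \<open>Listing a clique first keeps the search tree small.\<close>

abbreviation "search_order \<equiv> [8, 0, 4, 10, 11, 1, 7, 9, 5, 3, 6, 2 :: nat]"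

lemma set_search_order: "set search_order = {0..11}"
  unfolding atLeastAtMost_0_11 by code_simp

lemma H_edge_image: "H_edge ` {0..11} = edges graph_H"
proof -
  have "H_edge ` {0..11} = set (map H_edge [0..<12])" by (simp add: atLeastAtMost_0_11 del: upt_Suc)
  also have "\<dots> = edges graph_H"
    unfolding H_edge_def graph_H_def by code_simp
  finally show ?thesis .
qed

lemma H_edge_inj: "inj_on H_edge {0..11}"
proof -
  have "distinct (map H_edge [0..<12])" unfolding H_edge_def by code_simp
  then show ?thesis by (simp add: distinct_map atLeastAtMost_0_11 del: upt_Suc)
qed

lemma H_edge_meet:
  assumes "i \<in> {0..11}" "j \<in> {0..11}"
  shows "i \<noteq> j \<and> H_edge i \<inter> H_edge j \<noteq> {} \<longleftrightarrow> j \<in> set (nbrs i)"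
proof -
  have "\<forall>i\<in>set [0..<12]. \<forall>j\<in>set [0..<12]. (i \<noteq> j \<and> H_edge i \<inter> H_edge j \<noteq> {}) \<longleftrightarrow> j \<in> set (nbrs i)"
    by code_simp
  then show ?thesis using assms unfolding atLeastAtMost_0_11 by blast
qed

lemma nbrs_range: "j \<in> set (nbrs i) \<Longrightarrow> i \<in> {0..11} \<and> j \<in> {0..11}"
proof -
  assume j: "j \<in> set (nbrs i)"
  then have i: "i \<in> {0..11}" by (cases "i \<le> 11") (auto simp: nbrs_def)
  have "\<forall>i\<in>set [0..<12]. \<forall>j\<in>set (nbrs i). j \<le> 11" by code_simp
  then have "j \<le> 11" using i j unfolding atLeastAtMost_0_11 by blast
  then show ?thesis using i by simp
qed

lemma graph6_edge_iff: "{i, j} \<in> edges graph6_decoded \<longleftrightarrow> j \<in> set (nbrs i)"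
proof
  show "{i, j} \<in> edges graph6_decoded \<Longrightarrow> j \<in> set (nbrs i)"
    by (auto simp: graph6_decoded_def nbrs_def doubleton_eq_iff)
next
  have "\<forall>i\<in>set [0..<12]. \<forall>j\<in>set (nbrs i). {i, j} \<in> edges graph6_decoded"
    unfolding graph6_decoded_def by code_simp
  moreover assume "j \<in> set (nbrs i)"
  moreover from this have "i \<in> set [0..<12]" using nbrs_range atLeastAtMost_0_11 by blast
  ultimately show "{i, j} \<in> edges graph6_decoded" by blast
qed

lemma graph6_edgeE:
  assumes "e \<in> edges graph6_decoded" obtains i j where "e = {i, j}" "j \<in> set (nbrs i)"
proof -
  have "\<exists>i j. e = {i, j}" using assms by (auto simp: graph6_decoded_def)
  then show ?thesis using that assms graph6_edge_iff by auto
qed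

lemma card_edges_graph6: "card (edges graph6_decoded) = 22"
  unfolding graph6_decoded_def by code_simp

abbreviation (input) "LH \<equiv> line_graph graph_H"

lemma verts_LH: "verts LH = H_edge ` {0..11}"
  by (simp add: line_graph_def H_edge_image)

lemma edges_LH: "edges LH = (`) H_edge ` edges graph6_decoded"
proof (intro equalityI subsetI)
  fix x assume "x \<in> edges LH"
  then obtain e e' where e: "e \<in> H_edge ` {0..11}" "e' \<in> H_edge ` {0..11}"
    and xe: "x = {e, e'}" "e \<noteq> e'" "e \<inter> e' \<noteq> {}"
    unfolding line_graph_def H_edge_image by auto
  from e obtain i j where ij: "i \<in> {0..11}" "j \<in> {0..11}" and "e = H_edge i" "e' = H_edge j"
    by blast
  with xe have x: "x = {H_edge i, H_edge j}" and "H_edge i \<noteq> H_edge j" "H_edge i \<inter> H_edge j \<noteq> {}"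
    by auto
  then have "{i, j} \<in> edges graph6_decoded"
    using H_edge_meet[OF ij] graph6_edge_iff by blast
  then show "x \<in> (`) H_edge ` edges graph6_decoded" using x by (auto intro: rev_image_eqI)
next
  fix x assume "x \<in> (`) H_edge ` edges graph6_decoded"
  then obtain i j where x: "x = {H_edge i, H_edge j}" and j: "j \<in> set (nbrs i)"
    by (auto elim: graph6_edgeE)
  have ij: "i \<in> {0..11}" "j \<in> {0..11}" using nbrs_range[OF j] by auto
  then have "i \<noteq> j" "H_edge i \<inter> H_edge j \<noteq> {}" using H_edge_meet[OF ij] j by auto
  moreover have "H_edge i \<noteq> H_edge j" using inj_onD[OF H_edge_inj _ ij] \<open>i \<noteq> j\<close> by blast
  moreover have "H_edge i \<in> edges graph_H" "H_edge j \<in> edges graph_H"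
    using ij H_edge_image by blast+
  ultimately show "x \<in> edges LH" unfolding line_graph_def x by auto
qed

lemma edges_graph6_Pow: "edges graph6_decoded \<subseteq> Pow {0..11}"
  by (auto elim!: graph6_edgeE dest: nbrs_range)

lemma graph_iso_LH: "graph_iso LH graph6_decoded"
proof -
  let ?f = "inv_into {0..11} H_edge"
  have "bij_betw H_edge {0..11} (verts LH)"
    using H_edge_inj verts_LH by (simp add: bij_betw_def)
  then have "bij_betw ?f (verts LH) (verts graph6_decoded)"
    by (simp add: bij_betw_inv_into graph6_decoded_def)
  moreover have "?f ` H_edge ` e = e" if "e \<in> edges graph6_decoded" for e
  proof -
    have "e \<subseteq> {0..11}" using that edges_graph6_Pow by blast
    then show ?thesis by (rule inv_into_image_cancel[OF H_edge_inj])
  qed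
  then have "(\<lambda>e. ?f ` e) ` edges LH = edges graph6_decoded"
    by (simp add: edges_LH image_image)
  ultimately show ?thesis by (auto simp: graph_iso_def)
qed

lemma card_edges_LH: "card (edges LH) = 22"
proof -
  have "inj_on ((`) H_edge) (edges graph6_decoded)"
    using inj_on_image_Pow[OF H_edge_inj] edges_graph6_Pow by (rule inj_on_subset)
  then show ?thesis by (simp add: edges_LH card_image card_edges_graph6)
qed

lemma connected_LH: "connected_graph LH"
proof -
  let ?R = "{(x, y). {x, y} \<in> edges LH}"
  have step: "(H_edge 0, H_edge j) \<in> ?R\<^sup>*" if "(H_edge 0, H_edge i) \<in> ?R\<^sup>*" "j \<in> set (nbrs i)" for i j
  proof -
    have "{i, j} \<in> edges graph6_decoded" using that(2) graph6_edge_iff by blast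
    then have "{H_edge i, H_edge j} \<in> edges LH" unfolding edges_LH by (rule rev_image_eqI) simp
    then show ?thesis using that(1) by (simp add: rtrancl.rtrancl_into_rtrancl)
  qed
  \<comment> \<open>The search from 0 reaches 4, 6, 8, 10 directly, then 3, 11 through 8, then 1, 5
    through 10, then 7, 9 through 11, and 2 through 7.\<close>
  have r0: "(H_edge 0, H_edge 0) \<in> ?R\<^sup>*" by simp
  have r: "(H_edge 0, H_edge 4) \<in> ?R\<^sup>*" "(H_edge 0, H_edge 6) \<in> ?R\<^sup>*"
    "(H_edge 0, H_edge 8) \<in> ?R\<^sup>*" "(H_edge 0, H_edge 10) \<in> ?R\<^sup>*"
    by (rule step[OF r0], simp add: nbrs_def)+
  have r': "(H_edge 0, H_edge 3) \<in> ?R\<^sup>*" "(H_edge 0, H_edge 11) \<in> ?R\<^sup>*"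
    by (rule step[OF r(3)], simp add: nbrs_def)+
  have r'': "(H_edge 0, H_edge 1) \<in> ?R\<^sup>*" "(H_edge 0, H_edge 5) \<in> ?R\<^sup>*"
    by (rule step[OF r(4)], simp add: nbrs_def)+
  have r''': "(H_edge 0, H_edge 7) \<in> ?R\<^sup>*" "(H_edge 0, H_edge 9) \<in> ?R\<^sup>*"
    by (rule step[OF r'(2)], simp add: nbrs_def)+
  have r2: "(H_edge 0, H_edge 2) \<in> ?R\<^sup>*"
    by (rule step[OF r'''(1)], simp add: nbrs_def)
  have "\<forall>i\<in>{0..11}. (H_edge 0, H_edge i) \<in> ?R\<^sup>*"
    unfolding set_search_order[symmetric] using r0 r r' r'' r''' r2 by simp
  then have reach: "(H_edge 0, v) \<in> ?R\<^sup>*" if "v \<in> verts LH" for v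
    using that verts_LH by auto
  have "sym ?R" by (auto simp: sym_def insert_commute)
  then have "(u, v) \<in> ?R\<^sup>*" if "u \<in> verts LH" "v \<in> verts LH" for u v
    using reach[OF that(1)] reach[OF that(2)] by (meson rtrancl_trans sym_rtrancl symD)
  moreover have "verts LH \<noteq> {}" by (simp add: verts_LH)
  ultimately show ?thesis by (simp add: connected_graph_def)
qed

lemma finite_verts_LH: "finite (verts LH)"
  by (simp add: verts_LH)

lemma chromatic_LH_peel_count:
  "chromatic_symmetric_function LH (content_mset as)
    = int (peel_count (colour_layer (edges graph6_decoded)) (set search_order) as)"
  using peel_count_image[OF H_edge_inj edges_graph6_Pow, of "{0..11}" as]
  by (simp only: chromatic_content[OF finite_verts_LH] verts_LH edges_LH set_search_order)

lemma adjacency: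
  "symp (\<lambda>i j. j \<in> set (nbrs i))" "irreflp (\<lambda>i j. j \<in> set (nbrs i))"
proof -
  show "symp (\<lambda>i j. j \<in> set (nbrs i))"
    by (rule sympI) (simp add: insert_commute flip: graph6_edge_iff)
  show "irreflp (\<lambda>i j. j \<in> set (nbrs i))"
    by (rule irreflpI) (use H_edge_meet nbrs_range in blast)
qed

lemma chromatic_LH_eval:
  "chromatic_symmetric_function LH (content_mset as)
    = colouring_eval (\<lambda>i j. j \<in> set (nbrs i)) search_order as"
  unfolding chromatic_LH_peel_count by (rule colouring_eval[OF adjacency graph6_edge_iff]) simp

text \<open>Stable sets of the line graph are matchings of \<open>graph_H\<close>. Five edges would
  cover all ten vertices, hence include both pendant edges and leave two triangles with no edge
  between them, which cannot be matched. The evaluated search confirms this.\<close>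

lemma chromatic_LH_large:
  assumes "5 \<le> a" shows "chromatic_symmetric_function LH (content_mset (a # as)) = 0"
proof -
  have "stable_rests (\<lambda>i j. j \<in> set (nbrs i)) [] 5 search_order = []" by code_simp
  then show ?thesis
    unfolding chromatic_LH_peel_count
    using no_large_stable_set[OF adjacency graph6_edge_iff _ _ assms, of search_order as] by simp
qed

section \<open>The triangular system for the coefficient\<close>

section \<open>The coefficient\<close>

text \<open>With parts at most 4, two parts reach at most 8 and three reach 12 only as 4 + 4 + 4;
  four parts are left to linear arithmetic.\<close>

lemma partition_cases:
  assumes "is_partition p" "sum_list p = 12" "length p \<le> 4" "rows p 0 \<le> 4"
  shows "p \<in> {[4,4,4], [4,4,3,1], [4,4,2,2], [4,3,3,2], [3,3,3,3]}"
proof -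
  consider "p = []" | a where "p = [a]" | a b where "p = [a, b]" | a b c where "p = [a, b, c]"
    | a b c d where "p = [a, b, c, d]"
    using assms(3) by (auto simp: neq_Nil_conv le_Suc_eq length_Suc_conv numeral_eq_Suc)
  then show ?thesis
  proof cases
    case 5
    with assms have "a \<le> 4" "b \<le> a" "c \<le> b" "d \<le> c" "0 < d" "a + b + c + d = 12"
      by (auto simp: is_partition_def)
    then have "a = 3 \<and> b = 3 \<and> c = 3 \<and> d = 3 \<or> a = 4 \<and> d = 1 \<and> b = 4 \<and> c = 3
        \<or> a = 4 \<and> d = 2 \<and> (b = 4 \<and> c = 2 \<or> b = 3 \<and> c = 3)"
      by linarith
    then show ?thesis unfolding 5 by auto
  qed (use assms in \<open>auto simp: is_partition_def\<close>)
qed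

abbreviation "box_partitions \<equiv> [[4,4,4], [4,4,3,1], [4,4,2,2], [4,3,3,2], [3,3,3,3]]"

text \<open>Rows are indexed by contents and columns by shapes, both in decreasing lexicographic
  order, so the zeros above the diagonal reflect triangularity.\<close>

lemma kostka_values:
  "map (\<lambda>m. map (\<lambda>p. kostka p m) box_partitions) box_partitions =
    [[1, 0, 0, 0, 0], [1, 1, 0, 0, 0], [1, 1, 1, 0, 0], [1, 2, 1, 1, 0], [1, 3, 2, 3, 1]]"
  unfolding kostka_eval by code_simp

lemma chromatic_LH_values:
  "map (\<lambda>m. chromatic_symmetric_function LH (content_mset m)) (butlast box_partitions) = [0, 0, 128, 320]"
  unfolding chromatic_LH_eval by code_simp

lemma chromatic_LH_3333: "chromatic_symmetric_function LH (content_mset [3,3,3,3]) = 768"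
  unfolding chromatic_LH_eval by code_simp

lemma schur_coeff_LH: "schur_coeff (chromatic_symmetric_function LH) [3,3,3,3] = -64"
proof -
  let ?f = "chromatic_symmetric_function LH"
  let ?P = "{[4,4,4], [4,4,3,1], [4,4,2,2], [4,3,3,2], [3,3,3,3]} :: nat list set"
  obtain c where c: "is_schur_expansion ?f c"
    using chromatic_schur_expansion[OF finite_verts_LH] by blast
  let ?A = "{p. c p \<noteq> 0}"
  have A: "finite ?A" "\<And>p. p \<in> ?A \<Longrightarrow> is_partition p"
    using c by (auto simp: is_schur_expansion_def)
  \<comment> \<open>If a content starts with a part of size at least 5, so does every shape with
    nonzero Kostka number there, and the series vanishes at such contents; hence these coefficients
    are 0.\<close>
  have small: "rows p 0 \<le> 4" if p: "p \<in> ?A" for p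
  proof (rule ccontr)
    assume "\<not> rows p 0 \<le> 4"
    let ?U = "{p. is_partition p \<and> 5 \<le> rows p 0}"
    have head: "\<exists>a as. m = a # as \<and> 5 \<le> a" if "m \<in> ?U" for m
      using that by (cases m) auto
    have "c p = 0"
    proof (rule schur_coefficients_vanish[OF A, where U = ?U])
      show "is_partition m \<and> (is_partition q \<longrightarrow> kostka q m \<noteq> 0 \<longrightarrow> q \<in> ?U)" if "m \<in> ?U" for m q
        using head[OF that] that kostka_first_part[of q] by (fastforce simp: is_partition_def)
      show "(\<Sum>p\<in>?A. c p * int (kostka p m)) = 0" if "m \<in> ?U" for m
        using head[OF that] chromatic_LH_large schur_expansion_content[OF c, of m] by auto
    qed (use p A(2) \<open>\<not> rows p 0 \<le> 4\<close> in auto)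
    then show False using p by simp
  qed
  \<comment> \<open>A contributing shape has sum 12 and at most four rows; with \<open>small\<close>
    it is one of the five in \<open>?P\<close>. Length 3 is allowed for the content
    \<open>[4,4,4]\<close>.\<close>
  have eq: "?f (content_mset m) = (\<Sum>p\<in>?P. c p * int (kostka p m))"
    if m: "sum_list m = 12" "length m = 4 \<or> length m = 3" for m
  proof -
    have "p \<in> ?P" if "p \<in> ?A" "kostka p m \<noteq> 0" for p
    proof (rule partition_cases)
      show "sum_list p = 12" using kostka_sum[OF _ that(2)] A(2)[OF that(1)] m(1) by (simp add: is_partition_def)
      show "length p \<le> 4" using kostka_length[OF A(2)[OF that(1)] that(2)] m(2) by auto
    qed (use that A(2) small in auto)
    then have "(\<Sum>p\<in>?A. c p * int (kostka p m)) = (\<Sum>p\<in>?A \<inter> ?P. c p * int (kostka p m))"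
      using A(1) by (intro sum.mono_neutral_right) auto
    also have "\<dots> = (\<Sum>p\<in>?P. c p * int (kostka p m))"
      by (rule sum.mono_neutral_left) auto
    finally show ?thesis using schur_expansion_content[OF c] by simp
  qed
  \<comment> \<open>Substitution in this order gives the coefficients 0, 0, 128, 192 and finally
    -64.\<close>
  have "c [3,3,3,3] = -64"
    using eq[of "[4,4,4]"] eq[of "[4,4,3,1]"] eq[of "[4,4,2,2]"] eq[of "[4,3,3,2]"] eq[of "[3,3,3,3]"]
    by (simp add: kostka_values[simplified] chromatic_LH_values[simplified] chromatic_LH_3333[simplified])
  then show ?thesis using schur_coeff_eq[OF c] by simp
qed

theorem theorem1:
  fixes G :: "vtx set ugraph"
  defines "G \<equiv> line_graph graph_H"
  shows "card (verts G) = 12 \<and> card (edges G) = 22 \<and> graph_iso G graph6_decoded \<and>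
    connected_graph G \<and> claw_free G \<and>
    schur_coeff (chromatic_symmetric_function G) [3, 3, 3, 3] = -64"
  unfolding G_def
  using card_edges_LH graph_iso_LH connected_LH claw_free_line_graph[OF simple_graph_H] schur_coeff_LH
  by (simp add: verts_LH card_image[OF H_edge_inj])

end
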